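(* Let $D$ be a distributive lattice with zero. Let $K$ be a finite lattice, let $P$ and $Q$ be partial lattices, each of which is either a finite partial lattice or a lattice, let $f\colon K\to P$ and $g\colon K\to Q$ be homomorphisms of partial lattices, and let $\mu\colon\mathrm{Con}_cP\to D$ and $\nu\colon\mathrm{Con}_cQ\to D$ be $\{\vee,0\}$-homomorphisms such that $\mu\circ\mathrm{Con}_cf=\nu\circ\mathrm{Con}_cg$. Then there exist a lattice $L$, homomorphisms of partial lattices $\overline f\colon P\to L$ and $\overline g\colon Q\to L$, and a $\{\vee,0\}$-homomorphism $\varphi\colon\mathrm{Con}_cL\to D$ such that $\overline f\circ f=\overline g\circ g$, $\mu=\varphi\circ\mathrm{Con}_c\overline f$, and $\nu=\varphi\circ\mathrm{Con}_c\overline g$. Furthermore, the construction can be done in such a way that: 1. $L$ is generated, as a lattice, by $\overline f[P]\cup\overline g[Q]$; 2. the map $\varphi$ isolates $0$, i.e., $\varphi(\theta)=0$ if and only if $\theta=0$, for all $\theta\in\mathrm{Con}_cL$.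
   Context: **Partial lattices.** $[X]^{<\omega}_*$ is the set of nonempty finite subsets of $X$. For a preordering $\le$ on $P$, "$a=\sup X$" means that $x\le a$ for all $x\in X$ and that $a\le b$ whenever $x\le b$ for all $x\in X$; $\inf$ is dual. A *partial prelattice* is $\langle P,\le,\bigvee,\bigwedge\rangle$ with $P$ a nonempty set, $\le$ a preordering on $P$, and $\bigvee,\bigwedge$ partial functions from $[P]^{<\omega}_*$ to $P$ such that $a=\bigvee X$ implies $a=\sup X$ and $a=\bigwedge X$ implies $a=\inf X$. It is a *partial lattice* if $\le$ is antisymmetric. Lattices are identified with partial lattices in which $\bigvee,\bigwedge$ are defined on all of $[P]^{<\omega}_*$. A *homomorphism* of partial lattices is an order-preserving map $f$ such that $a=\bigvee X$ implies $f(a)=\bigvee f[X]$ and $a=\bigwedge X$ implies $f(a)=\bigwedge f[X]$. **Congruences.** A *congruence* of a partial lattice $P$ is a preordering $\preceq$ of $P$ containing $\le$ such that $\langle P,\preceq,\bigvee,\bigwedge\rangle$ is a partial prelattice. (For a lattice this is equivalent to the usual notion and gives an isomorphic congruence lattice.) Ordered by inclusion the congruences form an algebraic lattice; $\mathrm{Con}_c\,P$ is the $\{\vee,0\}$-semilattice of its compact elements, whose zero is the ordering of $P$. For a homomorphism $f\colon P\to Q$, $\mathrm{Con}_c f\colon\mathrm{Con}_c P\to\mathrm{Con}_c Q$ sends $\alpha$ to the congruence of $Q$ generated by all $\langle f(x),f(y)\rangle$ with $\langle x,y\rangle\in\alpha$. A $\{\vee,0\}$-homomorphism preserves binary joins and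 $0$. *)

theory Defs
  imports Complex_Main "HOL.Hull"
begin

text \<open>The partial operations are partial maps on sets; \<open>is_partial_prelattice\<close> confines their
  domains to the nonempty finite subsets of the carrier.\<close>

record 'a plat =
  carr :: "'a set"
  leq :: "'a rel"
  bjoin :: "'a set \<rightharpoonup> 'a"
  bmeet :: "'a set \<rightharpoonup> 'a"

definition fin_nonempty_subsets :: "'a set \<Rightarrow> 'a set set" where
  "fin_nonempty_subsets A = {X. X \<subseteq> A \<and> finite X \<and> X \<noteq> {}}"

text \<open>For a preordering, suprema and infima are determined only up to equivalence, hence
  relations rather than functions.\<close>

definition is_sup :: "'a set \<Rightarrow> 'a rel \<Rightarrow> 'a set \<Rightarrow> 'a \<Rightarrow> bool" where
  "is_sup A r X a \<longleftrightarrow>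
     a \<in> A \<and> (\<forall>x\<in>X. (x, a) \<in> r) \<and> (\<forall>b\<in>A. (\<forall>x\<in>X. (x, b) \<in> r) \<longrightarrow> (a, b) \<in> r)"

definition is_inf :: "'a set \<Rightarrow> 'a rel \<Rightarrow> 'a set \<Rightarrow> 'a \<Rightarrow> bool" where
  "is_inf A r X a \<longleftrightarrow>
     a \<in> A \<and> (\<forall>x\<in>X. (a, x) \<in> r) \<and> (\<forall>b\<in>A. (\<forall>x\<in>X. (b, x) \<in> r) \<longrightarrow> (b, a) \<in> r)"

definition is_partial_prelattice :: "'a plat \<Rightarrow> bool" where
  "is_partial_prelattice P \<longleftrightarrow>
     carr P \<noteq> {} \<and> preorder_on (carr P) (leq P) \<and>
     dom (bjoin P) \<subseteq> fin_nonempty_subsets (carr P) \<and> ran (bjoin P) \<subseteq> carr P \<and>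
     dom (bmeet P) \<subseteq> fin_nonempty_subsets (carr P) \<and> ran (bmeet P) \<subseteq> carr P \<and>
     (\<forall>X a. bjoin P X = Some a \<longrightarrow> is_sup (carr P) (leq P) X a) \<and>
     (\<forall>X a. bmeet P X = Some a \<longrightarrow> is_inf (carr P) (leq P) X a)"

definition is_partial_lattice :: "'a plat \<Rightarrow> bool" where
  "is_partial_lattice P \<longleftrightarrow> is_partial_prelattice P \<and> antisym (leq P)"

definition is_lattice :: "'a plat \<Rightarrow> bool" where
  "is_lattice P \<longleftrightarrow>
     is_partial_lattice P \<and>
     dom (bjoin P) = fin_nonempty_subsets (carr P) \<and> dom (bmeet P) = fin_nonempty_subsets (carr P)"

definition plat_hom :: "'a plat \<Rightarrow> 'b plat \<Rightarrow> ('a \<Rightarrow> 'b) \<Rightarrow> bool" where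
  "plat_hom P Q f \<longleftrightarrow>
     f ` carr P \<subseteq> carr Q \<and>
     (\<forall>(x, y) \<in> leq P. (f x, f y) \<in> leq Q) \<and>
     (\<forall>X a. bjoin P X = Some a \<longrightarrow> bjoin Q (f ` X) = Some (f a)) \<and>
     (\<forall>X a. bmeet P X = Some a \<longrightarrow> bmeet Q (f ` X) = Some (f a))"

definition sublattice :: "'a plat \<Rightarrow> 'a set \<Rightarrow> bool" where
  "sublattice L S \<longleftrightarrow>
     S \<subseteq> carr L \<and>
     (\<forall>X \<in> fin_nonempty_subsets S. \<forall>a. bjoin L X = Some a \<or> bmeet L X = Some a \<longrightarrow> a \<in> S)"

definition congruence :: "'a plat \<Rightarrow> 'a rel \<Rightarrow> bool" where
  "congruence P \<theta> \<longleftrightarrow> leq P \<subseteq> \<theta> \<and> is_partial_prelattice (P\<lparr>leq := \<theta>\<rparr>)"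

lemma congruence_top:
  assumes "is_partial_prelattice P"
  shows "congruence P (carr P \<times> carr P)"
proof -
  have "is_sup (carr P) (carr P \<times> carr P) X a" if "bjoin P X = Some a" for X a
  proof -
    have "X \<subseteq> carr P"
      using assms that unfolding is_partial_prelattice_def fin_nonempty_subsets_def by blast
    moreover have "a \<in> carr P"
      using assms that unfolding is_partial_prelattice_def is_sup_def by blast
    ultimately show ?thesis unfolding is_sup_def by blast
  qed
  moreover have "is_inf (carr P) (carr P \<times> carr P) X a" if "bmeet P X = Some a" for X a
  proof -
    have "X \<subseteq> carr P"
      using assms that unfolding is_partial_prelattice_def fin_nonempty_subsets_def by blast
    moreover have "a \<in> carr P"
      using assms that unfolding is_partial_prelattice_def is_inf_def by blast
    ultimately show ?thesis unfolding is_inf_def by blast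
  qed
  moreover have "preorder_on (carr P) (carr P \<times> carr P)"
    by (auto simp: preorder_on_def refl_on_def trans_def)
  ultimately show ?thesis
    using assms by (simp add: congruence_def is_partial_prelattice_def preorder_on_def)
qed

lemma congruence_Inter:
  assumes ne: "S \<noteq> {}" and S: "\<And>\<theta>. \<theta> \<in> S \<Longrightarrow> congruence P \<theta>"
  shows "congruence P (\<Inter>S)"
proof -
  have C: "leq P \<subseteq> \<theta>" "is_partial_prelattice (P\<lparr>leq := \<theta>\<rparr>)" if "\<theta> \<in> S" for \<theta>
    using S[OF that] by (auto simp: congruence_def)
  have "preorder_on (carr P) (\<Inter>S)"
    unfolding preorder_on_def
  proof (intro conjI)
    show "\<Inter>S \<subseteq> carr P \<times> carr P"
    proof -
      obtain \<theta> where \<theta>: "\<theta> \<in> S" using ne by blast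
      then have "\<theta> \<subseteq> carr P \<times> carr P"
        using C(2)[OF \<theta>] by (simp add: is_partial_prelattice_def preorder_on_def)
      then show ?thesis using \<theta> by blast
    qed
    show "refl_on (carr P) (\<Inter>S)"
      using C(2) by (simp add: is_partial_prelattice_def preorder_on_def refl_on_def)
    show "trans (\<Inter>S)"
    proof (rule transI)
      fix x y z assume xy: "(x, y) \<in> \<Inter>S" and yz: "(y, z) \<in> \<Inter>S"
      have "(x, z) \<in> \<theta>" if "\<theta> \<in> S" for \<theta>
      proof -
        have "trans \<theta>"
          using C(2)[OF that] by (simp add: is_partial_prelattice_def preorder_on_def)
        then show ?thesis using xy yz that by (meson InterE transD)
      qed
      then show "(x, z) \<in> \<Inter>S" by blast
    qed
  qed
  moreover have "is_sup (carr P) (\<Inter>S) X a" if "bjoin P X = Some a" for X a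
  proof -
    have "is_sup (carr P) \<theta> X a" if "\<theta> \<in> S" for \<theta>
      using C(2)[OF that] \<open>bjoin P X = Some a\<close> by (simp add: is_partial_prelattice_def)
    then show ?thesis using ne unfolding is_sup_def by blast
  qed
  moreover have "is_inf (carr P) (\<Inter>S) X a" if "bmeet P X = Some a" for X a
  proof -
    have "is_inf (carr P) \<theta> X a" if "\<theta> \<in> S" for \<theta>
      using C(2)[OF that] \<open>bmeet P X = Some a\<close> by (simp add: is_partial_prelattice_def)
    then show ?thesis using ne unfolding is_inf_def by blast
  qed
  moreover obtain \<theta> where "\<theta> \<in> S" using ne by blast
  moreover have "leq P \<subseteq> \<Inter>S" using C(1) by blast
  ultimately show ?thesis
    using C(2)[of \<theta>] by (simp add: congruence_def is_partial_prelattice_def)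
qed

lemma congruence_hull:
  assumes "is_partial_prelattice P" and "R \<subseteq> carr P \<times> carr P"
  shows "congruence P (congruence P hull R)"
  unfolding hull_def using assms congruence_top[of P] by (intro congruence_Inter) auto

lemma congruence_hull_empty:
  assumes "is_partial_prelattice P"
  shows "congruence P hull {} = leq P"
proof -
  have "congruence P (leq P)" using assms by (simp add: congruence_def)
  then show ?thesis by (auto simp: hull_def congruence_def)
qed

text \<open>By the lemmas above, \<open>congruence P hull R\<close> is the congruence
  generated by \<open>R\<close>, and the join of a set \<open>S\<close> of congruences is \<open>congruence P hull \<Union>S\<close>.
  The compact elements of the congruence lattice are defined order-theoretically.\<close>

definition Con_c :: "'a plat \<Rightarrow> 'a rel set" where
  "Con_c P = {\<alpha>. congruence P \<alpha> \<and>
     (\<forall>S. (\<forall>\<theta>\<in>S. congruence P \<theta>) \<and> \<alpha> \<subseteq> congruence P hull \<Union>S \<longrightarrow>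
        (\<exists>T\<subseteq>S. finite T \<and> \<alpha> \<subseteq> congruence P hull \<Union>T))}"

definition con_join :: "'a plat \<Rightarrow> 'a rel \<Rightarrow> 'a rel \<Rightarrow> 'a rel" where
  "con_join P \<alpha> \<beta> = congruence P hull (\<alpha> \<union> \<beta>)"

definition Con_c_map :: "'b plat \<Rightarrow> ('a \<Rightarrow> 'b) \<Rightarrow> 'a rel \<Rightarrow> 'b rel" where
  "Con_c_map Q f \<alpha> = congruence Q hull (map_prod f f ` \<alpha>)"

text \<open>The zero of the semilattice \<open>Con_c P\<close> is the ordering of \<open>P\<close>.\<close>

definition join_zero_hom :: "'a plat \<Rightarrow> ('a rel \<Rightarrow> 'd::{distrib_lattice, order_bot}) \<Rightarrow> bool" where
  "join_zero_hom P \<mu> \<longleftrightarrow>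
     \<mu> (leq P) = bot \<and> (\<forall>\<alpha>\<in>Con_c P. \<forall>\<beta>\<in>Con_c P. \<mu> (con_join P \<alpha> \<beta>) = sup (\<mu> \<alpha>) (\<mu> \<beta>))"

text \<open>Lattice terms over \<open>'a\<close>. Sets of terms serve as the elements of the amalgamating lattice:
  a lattice generated by images of \<open>'p\<close> and \<open>'q\<close> is a quotient of the algebra of lattice terms
  over \<open>'p + 'q\<close>, so up to isomorphism its elements are equivalence classes of such terms.\<close>

datatype 'a lterm = Gen 'a | Join "'a lterm" "'a lterm" | Meet "'a lterm" "'a lterm"

end

theory Submission imports Defs begin

text \<open>
  The map \<open>\<mu>\<close> assigns to \<open>x, y\<close> the value \<open>\<parallel>x \<le> y\<parallel> = \<mu> (\<Theta>\<^sup>+(x, y))\<close>, the failure of \<open>x \<le> y\<close> measured in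
  \<open>'d\<close>. Every homomorphism \<open>h\<close> from \<open>'d\<close> to the two-element lattice (equivalently, every prime ideal, \<open>'d\<close> itself admitted)
  turns \<open>P\<close>, \<open>Q\<close> and \<open>K\<close> into partial prelattices in which \<open>x \<le> y\<close> means \<open>\<not> h \<parallel>x \<le> y\<parallel>\<close>, and \<open>K\<close> embeds
  into both \<open>P\<close> and \<open>Q\<close> because the two composites into \<open>'d\<close> agree. For each \<open>h\<close> we glue \<open>P\<close> and \<open>Q\<close>
  along \<open>K\<close> and form the free lattice over the result; \<open>L\<close> consists of the lattice terms modulo
  equality at all \<open>h\<close>. By Dean's solution of the word problem, \<open>s \<le> t\<close> at \<open>h\<close> is a finite positive
  condition on the relations at \<open>h\<close>, uniformly in \<open>h\<close>; this is where the finiteness of \<open>K\<close> and the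
  dichotomy for \<open>P\<close> and \<open>Q\<close> enter. Hence \<open>{h. \<not> s \<le> t at h}\<close> is \<open>{h. h d}\<close> for a unique \<open>d\<close>, which is
  the value of \<open>\<phi>\<close> at the principal congruence of \<open>(s, t)\<close>.
\<close>

section \<open>Points of a distributive lattice\<close>

text \<open>In \<open>'d\<close> only finite joins and meets are available, while the lattice to be
  built may be infinite. Evaluation at a point replaces values in \<open>'d\<close> by truth values:
  at each \<open>h\<close> the task is the two-valued one of amalgamating two preordered partial
  lattices and completing the result to a lattice. Distributivity is what makes the points separate
  \<open>'d\<close>. The price is paid on the way back: a truth value for each \<open>h\<close>
  comes from an element of \<open>'d\<close> only if finitely many joins and meets express it. Hence
  every existential, whether over crossings between \<open>P\<close> and \<open>Q\<close>, over
  members of a generated ideal or over Dean's interpolant, must be bounded by a finite set that is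
  the same at all points. This is possible because the partial operations stay fixed and only the
  preorder varies with \<open>h\<close>. Isolation of 0 then comes for free, since equality in
  \<open>L\<close> is equality at all points.\<close>

definition points :: "('d::{distrib_lattice, order_bot} \<Rightarrow> bool) set" where
  "points = {h. \<not> h bot \<and> (\<forall>a b. h (sup a b) \<longleftrightarrow> h a \<or> h b) \<and> (\<forall>a b. h (inf a b) \<longleftrightarrow> h a \<and> h b)}"

lemma pointsD:
  assumes "h \<in> points"
  shows "\<not> h bot" "h (sup a b) \<longleftrightarrow> h a \<or> h b" "h (inf a b) \<longleftrightarrow> h a \<and> h b"
  using assms by (auto simp: points_def)

lemma const_False_point: "(\<lambda>_. False) \<in> points"
  by (simp add: points_def)

text \<open>The prime ideal theorem: an ideal maximal among those containing \<open>e\<close> and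
  avoiding \<open>d\<close> is prime, and the indicator of its complement is a point. Distributivity
  enters in the primality argument.\<close>

lemma points_separate:
  fixes d e :: "'d::{distrib_lattice, order_bot}"
  assumes "\<not> d \<le> e"
  shows "\<exists>h\<in>points. h d \<and> \<not> h e"
proof -
  \<comment> \<open>The single equivalence says both that \<open>I\<close> is closed under joins and
    that it is downward closed.\<close>
  define A where "A = {I. e \<in> I \<and> d \<notin> I \<and> (\<forall>a b. sup a b \<in> I \<longleftrightarrow> a \<in> I \<and> b \<in> I)}"
  have "{x. x \<le> e} \<in> A" using assms by (auto simp: A_def)
  moreover have "\<Union>C \<in> A" if "C \<noteq> {}" "subset.chain A C" for C
  proof -
    have C: "I \<in> A" if "I \<in> C" for I using that \<open>subset.chain A C\<close> by (auto simp: subset.chain_def)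
    have "sup a b \<in> \<Union>C" if "a \<in> \<Union>C" "b \<in> \<Union>C" for a b
    proof -
      obtain I I' where I: "I \<in> C" "I' \<in> C" "a \<in> I" "b \<in> I'" using \<open>a \<in> \<Union>C\<close> \<open>b \<in> \<Union>C\<close> by blast
      then have "I \<subseteq> I' \<or> I' \<subseteq> I" using \<open>subset.chain A C\<close> by (metis subset_chain_def)
      then obtain I'' where "I'' \<in> C" "a \<in> I''" "b \<in> I''" using I by blast
      then have "sup a b \<in> I''" using C[of I''] by (simp add: A_def)
      then show ?thesis using \<open>I'' \<in> C\<close> by blast
    qed
    moreover have "a \<in> \<Union>C \<and> b \<in> \<Union>C" if "sup a b \<in> \<Union>C" for a b
      using that C unfolding A_def by blast
    moreover have "e \<in> \<Union>C" "d \<notin> \<Union>C" using C \<open>C \<noteq> {}\<close> unfolding A_def by blast+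
    ultimately show ?thesis unfolding A_def by blast
  qed
  ultimately obtain I where I: "I \<in> A" and max: "\<And>I'. I' \<in> A \<Longrightarrow> I \<subseteq> I' \<Longrightarrow> I' = I"
    using subset_Zorn_nonempty[of A] by blast
  have IS: "sup a b \<in> I \<longleftrightarrow> a \<in> I \<and> b \<in> I" and eI: "e \<in> I" and dI: "d \<notin> I" for a b
    using I by (auto simp: A_def)
  have down: "a \<in> I" if "b \<in> I" "a \<le> b" for a b
    using IS[of a b] that by (simp add: sup_absorb2)
  \<comment> \<open>By maximality, the ideal generated by \<open>I\<close> and \<open>a\<close> must
    contain \<open>d\<close>.\<close>
  have ext: "\<exists>i\<in>I. d \<le> sup i a" if "a \<notin> I" for a
  proof (rule ccontr)
    assume no: "\<not> ?thesis"
    define I' where "I' = {x. \<exists>i\<in>I. x \<le> sup i a}"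
    have "sup x y \<in> I'" if "x \<in> I'" "y \<in> I'" for x y
    proof -
      obtain i j where ij: "i \<in> I" "j \<in> I" "x \<le> sup i a" "y \<le> sup j a"
        using \<open>x \<in> I'\<close> \<open>y \<in> I'\<close> by (auto simp: I'_def)
      have "x \<le> sup (sup i j) a" using ij(3) by (meson order_trans sup.cobounded1 sup_mono order_refl)
      moreover have "y \<le> sup (sup i j) a" using ij(4) by (meson order_trans sup.cobounded2 sup_mono order_refl)
      ultimately have "sup x y \<le> sup (sup i j) a" by simp
      then show ?thesis using ij IS unfolding I'_def by blast
    qed
    moreover have "x \<in> I' \<and> y \<in> I'" if "sup x y \<in> I'" for x y
      using that unfolding I'_def by auto
    moreover have "I \<subseteq> I'" unfolding I'_def using sup.cobounded1 by blast
    ultimately have "I' \<in> A" using no eI unfolding A_def I'_def by blast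
    then have "I' = I" using max \<open>I \<subseteq> I'\<close> by blast
    moreover have "a \<in> I'" using eI unfolding I'_def by auto
    ultimately show False using that by simp
  qed
  have prime: "inf a b \<in> I \<longleftrightarrow> a \<in> I \<or> b \<in> I" for a b
  proof
    assume ab: "inf a b \<in> I"
    show "a \<in> I \<or> b \<in> I"
    proof (rule ccontr)
      assume "\<not> ?thesis"
      then obtain i j where ij: "i \<in> I" "j \<in> I" "d \<le> sup i a" "d \<le> sup j b" using ext by meson
      have "d \<le> sup (sup i j) a" using ij(3) by (meson order_trans sup.cobounded1 sup_mono order_refl)
      moreover have "d \<le> sup (sup i j) b" using ij(4) by (meson order_trans sup.cobounded2 sup_mono order_refl)
      ultimately have "d \<le> sup (sup i j) (inf a b)" by (simp add: sup_inf_distrib1)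
      moreover have "sup (sup i j) (inf a b) \<in> I" using ij ab IS by blast
      ultimately show False using down dI by blast
    qed
  qed (auto intro: down)
  have "bot \<in> I" using down[OF eI] by simp
  then have "(\<lambda>x. x \<notin> I) \<in> points" using IS prime by (auto simp: points_def)
  then show ?thesis using dI eI by (intro bexI[of _ "\<lambda>x. x \<notin> I"]) auto
qed

lemma points_eqI:
  fixes d e :: "'d::{distrib_lattice, order_bot}"
  assumes "\<And>h. h \<in> points \<Longrightarrow> h d \<longleftrightarrow> h e"
  shows "d = e"
  using points_separate[of d e] points_separate[of e d] assms by (metis order_antisym)

text \<open>Without a top element in \<open>'d\<close>, the empty disjunction needs a separate clause.\<close>

definition definable :: "(('d::{distrib_lattice, order_bot} \<Rightarrow> bool) \<Rightarrow> bool) \<Rightarrow> bool" where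
  "definable p \<longleftrightarrow> (\<exists>d. \<forall>h\<in>points. p h \<longleftrightarrow> \<not> h d) \<or> (\<forall>h\<in>points. \<not> p h)"

lemma definable_cong:
  assumes "\<And>h. h \<in> points \<Longrightarrow> p h \<longleftrightarrow> q h"
  shows "definable p \<longleftrightarrow> definable q"
  using assms by (simp add: definable_def)

lemma definable_const: "definable (\<lambda>_. c)"
  using pointsD(1) by (cases c) (auto simp: definable_def)

text \<open>The representing element measures failure, so disjunction becomes \<open>inf\<close> and
  conjunction becomes \<open>sup\<close>. A condition that never holds may have no representing
  element, which forces the case split.\<close>

lemma definable_disj:
  assumes "definable p" "definable q"
  shows "definable (\<lambda>h. p h \<or> q h)"
proof (cases "(\<forall>h\<in>points. \<not> p h) \<or> (\<forall>h\<in>points. \<not> q h)")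
  case True
  then show ?thesis using assms definable_cong[of "\<lambda>h. p h \<or> q h" q] definable_cong[of "\<lambda>h. p h \<or> q h" p] by blast
next
  case False
  then obtain d e where "\<forall>h\<in>points. p h \<longleftrightarrow> \<not> h d" "\<forall>h\<in>points. q h \<longleftrightarrow> \<not> h e"
    using assms by (auto simp: definable_def)
  then have "\<forall>h\<in>points. (p h \<or> q h) \<longleftrightarrow> \<not> h (inf d e)" by (auto simp: pointsD)
  then show ?thesis unfolding definable_def by blast
qed

lemma definable_conj:
  assumes "definable p" "definable q"
  shows "definable (\<lambda>h. p h \<and> q h)"
proof (cases "(\<forall>h\<in>points. \<not> p h) \<or> (\<forall>h\<in>points. \<not> q h)")
  case True
  then show ?thesis by (auto simp: definable_def)
next
  case False
  then obtain d e where "\<forall>h\<in>points. p h \<longleftrightarrow> \<not> h d" "\<forall>h\<in>points. q h \<longleftrightarrow> \<not> h e"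
    using assms by (auto simp: definable_def)
  then have "\<forall>h\<in>points. (p h \<and> q h) \<longleftrightarrow> \<not> h (sup d e)" by (auto simp: pointsD)
  then show ?thesis unfolding definable_def by blast
qed

lemma definable_bex:
  assumes "finite S" "\<And>x. x \<in> S \<Longrightarrow> definable (\<lambda>h. p x h)"
  shows "definable (\<lambda>h. \<exists>x\<in>S. p x h)"
  using assms by (induction S) (auto intro: definable_disj definable_const)

lemma definable_ball:
  assumes "finite S" "\<And>x. x \<in> S \<Longrightarrow> definable (\<lambda>h. p x h)"
  shows "definable (\<lambda>h. \<forall>x\<in>S. p x h)"
  using assms by (induction S) (auto intro: definable_conj definable_const)

section \<open>Compact congruences\<close>

lemma congruenceD:
  assumes "congruence P \<theta>"
  shows "leq P \<subseteq> \<theta>" "preorder_on (carr P) \<theta>" "\<theta> \<subseteq> carr P \<times> carr P" "trans \<theta>"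
    "x \<in> carr P \<Longrightarrow> (x, x) \<in> \<theta>"
    "bjoin P X = Some a \<Longrightarrow> is_sup (carr P) \<theta> X a" "bmeet P X = Some a \<Longrightarrow> is_inf (carr P) \<theta> X a"
  using assms by (auto simp: congruence_def is_partial_prelattice_def preorder_on_def refl_on_def)

lemma plat_opsD:
  assumes "is_partial_prelattice P"
  shows "bjoin P X = Some a \<Longrightarrow> X \<subseteq> carr P \<and> finite X \<and> X \<noteq> {} \<and> a \<in> carr P"
    "bmeet P X = Some a \<Longrightarrow> X \<subseteq> carr P \<and> finite X \<and> X \<noteq> {} \<and> a \<in> carr P"
  using assms unfolding is_partial_prelattice_def fin_nonempty_subsets_def ran_def by blast+

lemma congruenceI:
  assumes "is_partial_prelattice P" "leq P \<subseteq> \<theta>" "\<theta> \<subseteq> carr P \<times> carr P" "trans \<theta>"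
    "\<And>X a. bjoin P X = Some a \<Longrightarrow> is_sup (carr P) \<theta> X a"
    "\<And>X a. bmeet P X = Some a \<Longrightarrow> is_inf (carr P) \<theta> X a"
  shows "congruence P \<theta>"
  using assms unfolding congruence_def is_partial_prelattice_def preorder_on_def refl_on_def by auto

lemma congruence_hull_least: "congruence P \<theta> \<Longrightarrow> R \<subseteq> \<theta> \<Longrightarrow> congruence P hull R \<subseteq> \<theta>"
  by (rule hull_minimal)

lemma congruence_prelattice: "is_partial_prelattice P \<Longrightarrow> congruence P (leq P)"
  by (simp add: congruence_def)

text \<open>Transitivity and the conditions on joins and meets have finitely many premises each, and
  in a directed family finitely many pairs lie in one member.\<close>

lemma congruence_directed_Union:
  assumes P: "is_partial_prelattice P" and ne: "S \<noteq> {}"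
    and S: "\<And>\<theta>. \<theta> \<in> S \<Longrightarrow> congruence P \<theta>"
    and dir: "\<And>\<alpha> \<beta>. \<alpha> \<in> S \<Longrightarrow> \<beta> \<in> S \<Longrightarrow> \<exists>\<gamma>\<in>S. \<alpha> \<union> \<beta> \<subseteq> \<gamma>"
  shows "congruence P (\<Union>S)"
proof (rule congruenceI[OF P])
  have fin: "\<exists>\<theta>\<in>S. F \<subseteq> \<theta>" if "finite F" "F \<subseteq> \<Union>S" for F
    using that
  proof (induction F)
    case (insert p F)
    then obtain \<alpha> \<beta> where "\<alpha> \<in> S" "p \<in> \<alpha>" "\<beta> \<in> S" "F \<subseteq> \<beta>" by auto
    then show ?case using dir[of \<alpha> \<beta>] by blast
  qed (use ne in auto)
  show "leq P \<subseteq> \<Union>S" using ne congruenceD(1)[OF S] by blast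
  show "\<Union>S \<subseteq> carr P \<times> carr P" using congruenceD(3)[OF S] by blast
  show "trans (\<Union>S)"
  proof (rule transI)
    fix x y z assume "(x, y) \<in> \<Union>S" "(y, z) \<in> \<Union>S"
    then obtain \<theta> where "\<theta> \<in> S" "(x, y) \<in> \<theta>" "(y, z) \<in> \<theta>" using fin[of "{(x, y), (y, z)}"] by auto
    then show "(x, z) \<in> \<Union>S" using congruenceD(4)[OF S] by (meson UnionI transD)
  qed
  obtain \<theta>0 where \<theta>0: "\<theta>0 \<in> S" using ne by blast
  show "is_sup (carr P) (\<Union>S) X a" if Xa: "bjoin P X = Some a" for X a
    unfolding is_sup_def
  proof (intro conjI ballI impI)
    fix b assume b: "b \<in> carr P" "\<forall>x\<in>X. (x, b) \<in> \<Union>S"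
    have "finite X" using plat_opsD(1)[OF P Xa] by simp
    then obtain \<theta> where "\<theta> \<in> S" "(\<lambda>x. (x, b)) ` X \<subseteq> \<theta>" using fin[of "(\<lambda>x. (x, b)) ` X"] b by auto
    then show "(a, b) \<in> \<Union>S" using congruenceD(6)[OF S Xa, of \<theta>] b(1) unfolding is_sup_def by blast
  qed (use congruenceD(6)[OF S Xa, OF \<theta>0] \<theta>0 in \<open>auto simp: is_sup_def\<close>)
  show "is_inf (carr P) (\<Union>S) X a" if Xa: "bmeet P X = Some a" for X a
    unfolding is_inf_def
  proof (intro conjI ballI impI)
    fix b assume b: "b \<in> carr P" "\<forall>x\<in>X. (b, x) \<in> \<Union>S"
    have "finite X" using plat_opsD(2)[OF P Xa] by simp
    then obtain \<theta> where "\<theta> \<in> S" "(\<lambda>x. (b, x)) ` X \<subseteq> \<theta>" using fin[of "(\<lambda>x. (b, x)) ` X"] b by auto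
    then show "(b, a) \<in> \<Union>S" using congruenceD(7)[OF S Xa, of \<theta>] b(1) unfolding is_inf_def by blast
  qed (use congruenceD(7)[OF S Xa, OF \<theta>0] \<theta>0 in \<open>auto simp: is_inf_def\<close>)
qed

text \<open>The join of \<open>S\<close> is the directed union \<open>\<Union>W\<close> of the joins
  of its finite subfamilies, and a finite \<open>F\<close> inside that union already lies in one of
  them.\<close>

lemma finitely_generated_compact:
  assumes P: "is_partial_prelattice P" and F: "finite F" "F \<subseteq> carr P \<times> carr P"
  shows "congruence P hull F \<in> Con_c P"
  unfolding Con_c_def
proof (intro CollectI conjI allI impI)
  show "congruence P (congruence P hull F)" using congruence_hull[OF P F(2)] .
  fix S assume S: "(\<forall>\<theta>\<in>S. congruence P \<theta>) \<and> congruence P hull F \<subseteq> congruence P hull \<Union>S"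
  define W where "W = {congruence P hull \<Union>T | T. T \<subseteq> S \<and> finite T}"
  have sub: "\<Union>T \<subseteq> carr P \<times> carr P" if "T \<subseteq> S" for T using S congruenceD(3) that by fast
  have dir: "\<exists>\<gamma>\<in>W. \<alpha> \<union> \<beta> \<subseteq> \<gamma>" if "\<alpha> \<in> W" "\<beta> \<in> W" for \<alpha> \<beta>
  proof -
    obtain T T' where "\<alpha> = congruence P hull \<Union>T" "\<beta> = congruence P hull \<Union>T'"
      "T \<subseteq> S" "finite T" "T' \<subseteq> S" "finite T'" using \<open>\<alpha> \<in> W\<close> \<open>\<beta> \<in> W\<close> unfolding W_def by blast
    then have "congruence P hull \<Union>(T \<union> T') \<in> W" "\<alpha> \<union> \<beta> \<subseteq> congruence P hull \<Union>(T \<union> T')"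
      unfolding W_def by (auto intro!: exI[of _ "T \<union> T'"] elim: hull_mono[THEN subsetD, rotated])
    then show ?thesis by blast
  qed
  have C: "congruence P (\<Union>W)"
  proof (rule congruence_directed_Union[OF P _ _ dir])
    show "W \<noteq> {}" unfolding W_def by blast
    show "congruence P \<theta>" if "\<theta> \<in> W" for \<theta>
      using that sub unfolding W_def by (auto intro!: congruence_hull[OF P])
  qed
  have "\<Union>S \<subseteq> \<Union>W"
  proof
    fix p assume "p \<in> \<Union>S"
    then obtain \<theta> where "\<theta> \<in> S" "p \<in> \<theta>" by blast
    then have "p \<in> congruence P hull \<Union>{\<theta>}" "congruence P hull \<Union>{\<theta>} \<in> W"
      unfolding W_def by (auto intro: hull_inc intro!: exI[of _ "{\<theta>}"])
    then show "p \<in> \<Union>W" by blast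
  qed
  then have "congruence P hull \<Union>S \<subseteq> \<Union>W" by (rule congruence_hull_least[OF C])
  then have "F \<subseteq> \<Union>W" using S hull_subset[of F "congruence P"] by blast
  have "\<exists>\<theta>\<in>W. G \<subseteq> \<theta>" if "finite G" "G \<subseteq> \<Union>W" for G
    using that
  proof (induction G)
    case empty
    then show ?case unfolding W_def by blast
  next
    case (insert p G)
    then obtain \<alpha> \<beta> where "\<alpha> \<in> W" "p \<in> \<alpha>" "\<beta> \<in> W" "G \<subseteq> \<beta>" by auto
    then show ?case using dir[of \<alpha> \<beta>] by blast
  qed
  from this[OF F(1) \<open>F \<subseteq> \<Union>W\<close>] obtain T where T: "T \<subseteq> S" "finite T" "F \<subseteq> congruence P hull \<Union>T" unfolding W_def by blast
  moreover have "congruence P hull F \<subseteq> congruence P hull \<Union>T"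
    using T(3) congruence_hull[OF P sub[OF T(1)]] by (rule congruence_hull_least[rotated])
  ultimately show "\<exists>T\<subseteq>S. finite T \<and> congruence P hull F \<subseteq> congruence P hull \<Union>T" by blast
qed

text \<open>Compactness is applied to the family of principal congruences of the pairs in
  \<open>\<alpha>\<close>.\<close>

lemma compact_finitely_generated:
  assumes P: "is_partial_prelattice P" and \<alpha>: "\<alpha> \<in> Con_c P"
  obtains F where "finite F" "F \<subseteq> \<alpha>" "F \<subseteq> carr P \<times> carr P" "\<alpha> = congruence P hull F"
proof -
  have c: "congruence P \<alpha>" using \<alpha> by (simp add: Con_c_def)
  have sub: "\<alpha> \<subseteq> carr P \<times> carr P" using congruenceD(3)[OF c] .
  define S where "S = (\<lambda>p. congruence P hull {p}) ` \<alpha>"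
  have "\<forall>\<theta>\<in>S. congruence P \<theta>" using sub congruence_hull[OF P] unfolding S_def by blast
  moreover have "\<alpha> \<subseteq> \<Union>S" unfolding S_def by (auto intro: hull_inc)
  then have "\<alpha> \<subseteq> congruence P hull \<Union>S" using hull_subset[of "\<Union>S" "congruence P"] by blast
  ultimately obtain T where T: "T \<subseteq> S" "finite T" "\<alpha> \<subseteq> congruence P hull \<Union>T"
    using \<alpha> unfolding Con_c_def by blast
  then obtain F where F: "F \<subseteq> \<alpha>" "finite F" "T = (\<lambda>p. congruence P hull {p}) ` F"
    unfolding S_def by (meson finite_subset_image)
  have cF: "congruence P (congruence P hull F)" using F(1) sub by (intro congruence_hull[OF P]) blast
  have "\<Union>T \<subseteq> congruence P hull F" unfolding F(3)
    by (auto dest!: hull_mono[of "{_}" F "congruence P", THEN subsetD, rotated])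
  then have "\<alpha> \<subseteq> congruence P hull F" using T(3) congruence_hull_least[OF cF] by blast
  moreover have "congruence P hull F \<subseteq> \<alpha>" using congruence_hull_least[OF c F(1)] .
  ultimately show ?thesis using that F sub by blast
qed

section \<open>Semilattice maps on compact congruences, seen through a point\<close>

lemma con_join_hull:
  assumes P: "is_partial_prelattice P" and "A \<subseteq> carr P \<times> carr P" "B \<subseteq> carr P \<times> carr P"
  shows "con_join P (congruence P hull A) (congruence P hull B) = congruence P hull (A \<union> B)"
  unfolding con_join_def
proof (rule antisym)
  show "congruence P hull (congruence P hull A \<union> congruence P hull B) \<subseteq> congruence P hull (A \<union> B)"
    using assms by (intro congruence_hull_least congruence_hull Un_least hull_mono) auto
  show "congruence P hull (A \<union> B) \<subseteq> congruence P hull (congruence P hull A \<union> congruence P hull B)"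
    by (intro hull_mono Un_mono hull_subset)
qed

text \<open>A point turns joins into disjunctions, so \<open>h\<close> composed with
  \<open>\<mu>\<close> is determined by its values on principal congruences.\<close>

lemma join_zero_hom_point:
  assumes P: "is_partial_prelattice P" and \<mu>: "join_zero_hom P \<mu>" and h: "h \<in> points"
    and F: "finite F" "F \<subseteq> carr P \<times> carr P"
  shows "h (\<mu> (congruence P hull F)) \<longleftrightarrow> (\<exists>p\<in>F. h (\<mu> (congruence P hull {p})))"
  using F
proof (induction F)
  case empty
  then show ?case using \<mu> pointsD(1)[OF h] by (simp add: congruence_hull_empty[OF P] join_zero_hom_def)
next
  case (insert p F)
  have "congruence P hull (insert p F) = con_join P (congruence P hull {p}) (congruence P hull F)"
    using con_join_hull[OF P, of "{p}" F] insert.prems by simp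
  then show ?case
    using insert \<mu> pointsD(2)[OF h] finitely_generated_compact[OF P]
    by (simp add: join_zero_hom_def)
qed

lemma join_zero_hom_point_mono:
  assumes P: "is_partial_prelattice P" and \<mu>: "join_zero_hom P \<mu>" and h: "h \<in> points"
    and "\<alpha> \<in> Con_c P" "\<beta> \<in> Con_c P" "\<alpha> \<subseteq> \<beta>" "h (\<mu> \<alpha>)"
  shows "h (\<mu> \<beta>)"
proof -
  have "con_join P \<alpha> \<beta> = \<beta>"
    using assms(5,6) by (simp add: con_join_def Un_absorb1 Con_c_def hull_same)
  then have "\<mu> \<beta> = sup (\<mu> \<alpha>) (\<mu> \<beta>)" using \<mu> assms(4,5) by (metis join_zero_hom_def)
  then show ?thesis using pointsD(2)[OF h] assms(7) by metis
qed

text \<open>Monotonicity lets all pairs of \<open>\<alpha>\<close> take the place of a chosen finite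
  generating set.\<close>

lemma join_zero_hom_point_iff:
  assumes P: "is_partial_prelattice P" and \<mu>: "join_zero_hom P \<mu>" and h: "h \<in> points"
    and \<alpha>: "\<alpha> \<in> Con_c P"
  shows "h (\<mu> \<alpha>) \<longleftrightarrow> (\<exists>p\<in>\<alpha>. h (\<mu> (congruence P hull {p})))"
proof
  obtain F where F: "finite F" "F \<subseteq> \<alpha>" "F \<subseteq> carr P \<times> carr P" "\<alpha> = congruence P hull F"
    using compact_finitely_generated[OF P \<alpha>] .
  then show "h (\<mu> \<alpha>) \<Longrightarrow> \<exists>p\<in>\<alpha>. h (\<mu> (congruence P hull {p}))"
    using join_zero_hom_point[OF P \<mu> h] by blast
  have c: "congruence P \<alpha>" using \<alpha> by (simp add: Con_c_def)
  assume "\<exists>p\<in>\<alpha>. h (\<mu> (congruence P hull {p}))"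
  then obtain p where p: "p \<in> \<alpha>" "h (\<mu> (congruence P hull {p}))" by blast
  then have "{p} \<subseteq> carr P \<times> carr P" using congruenceD(3)[OF c] by blast
  then show "h (\<mu> \<alpha>)"
    using join_zero_hom_point_mono[OF P \<mu> h _ \<alpha> congruence_hull_least[OF c] p(2)]
      finitely_generated_compact[OF P, of "{p}"] p(1) by simp
qed

text \<open>The union of the compact congruences that \<open>\<mu>\<close> sends into the prime
  ideal \<open>{d. \<not> h d}\<close>, described through principal congruences.\<close>

definition point_le :: "'a plat \<Rightarrow> ('a rel \<Rightarrow> 'd) \<Rightarrow> ('d \<Rightarrow> bool) \<Rightarrow> 'a rel" where
  "point_le P \<mu> h = {(x, y) \<in> carr P \<times> carr P. \<not> h (\<mu> (congruence P hull {(x, y)}))}"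

text \<open>The compact congruences whose value fails at \<open>h\<close> form an ideal of
  \<open>Con_c P\<close>, and the union of such an ideal is a congruence. Concretely,
  \<open>step\<close> says that whatever finitely many pairs of the relation generate is again in
  it; each axiom of a congruence is one such deduction.\<close>

lemma congruence_point_le:
  assumes P: "is_partial_prelattice P" and \<mu>: "join_zero_hom P \<mu>" and h: "h \<in> points"
  shows "congruence P (point_le P \<mu> h)"
proof -
  have step: "p \<in> point_le P \<mu> h"
    if F: "finite F" "F \<subseteq> point_le P \<mu> h" "p \<in> carr P \<times> carr P" "p \<in> congruence P hull F" for p F
  proof -
    have Fc: "F \<subseteq> carr P \<times> carr P" using F(2) by (auto simp: point_le_def)
    have "congruence P hull {p} \<subseteq> congruence P hull F"
      using F(4) congruence_hull[OF P Fc] by (intro congruence_hull_least) auto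
    moreover have "\<not> h (\<mu> (congruence P hull F))"
      using join_zero_hom_point[OF P \<mu> h F(1) Fc] F(2) by (auto simp: point_le_def)
    ultimately have "\<not> h (\<mu> (congruence P hull {p}))"
      using join_zero_hom_point_mono[OF P \<mu> h] finitely_generated_compact[OF P] F(1,3) Fc
      by (metis empty_subsetI finite.emptyI finite.insertI insert_subset)
    then show ?thesis using F(3) by (auto simp: point_le_def)
  qed
  show ?thesis
  proof (rule congruenceI[OF P])
    show le: "leq P \<subseteq> point_le P \<mu> h"
    proof
      fix p assume "p \<in> leq P"
      then show "p \<in> point_le P \<mu> h"
        using step[of "{}" p] congruenceD(3)[OF congruence_prelattice[OF P]] congruence_hull_empty[OF P] by auto
    qed
    show "point_le P \<mu> h \<subseteq> carr P \<times> carr P" by (auto simp: point_le_def)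
    then have cH: "congruence P (congruence P hull F)" if "F \<subseteq> point_le P \<mu> h" for F
      using that congruence_hull[OF P] by blast
    show "trans (point_le P \<mu> h)"
    proof (rule transI)
      fix x y z assume a: "(x, y) \<in> point_le P \<mu> h" "(y, z) \<in> point_le P \<mu> h"
      have "(x, z) \<in> congruence P hull {(x, y), (y, z)}"
        using congruenceD(4)[OF cH, of "{(x, y), (y, z)}"] a by (auto intro: hull_inc dest: transD)
      then show "(x, z) \<in> point_le P \<mu> h"
        using step[of "{(x, y), (y, z)}" "(x, z)"] a by (auto simp: point_le_def)
    qed
    show "is_sup (carr P) (point_le P \<mu> h) X a" if Xa: "bjoin P X = Some a" for X a
      unfolding is_sup_def
    proof (intro conjI ballI impI)
      show "a \<in> carr P" using plat_opsD(1)[OF P Xa] by simp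
      show "(x, a) \<in> point_le P \<mu> h" if "x \<in> X" for x
        using congruenceD(6)[OF congruence_prelattice[OF P] Xa] le that by (auto simp: is_sup_def)
      fix b assume b: "b \<in> carr P" "\<forall>x\<in>X. (x, b) \<in> point_le P \<mu> h"
      let ?F = "(\<lambda>x. (x, b)) ` X"
      have "?F \<subseteq> point_le P \<mu> h" using b(2) by blast
      then have "(a, b) \<in> congruence P hull ?F"
        using congruenceD(6)[OF cH Xa, of ?F] b(1) hull_subset[of ?F "congruence P"] unfolding is_sup_def by blast
      then show "(a, b) \<in> point_le P \<mu> h"
        using step[of ?F "(a, b)"] b plat_opsD(1)[OF P Xa] by auto
    qed
    show "is_inf (carr P) (point_le P \<mu> h) X a" if Xa: "bmeet P X = Some a" for X a
      unfolding is_inf_def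
    proof (intro conjI ballI impI)
      show "a \<in> carr P" using plat_opsD(2)[OF P Xa] by simp
      show "(a, x) \<in> point_le P \<mu> h" if "x \<in> X" for x
        using congruenceD(7)[OF congruence_prelattice[OF P] Xa] le that by (auto simp: is_inf_def)
      fix b assume b: "b \<in> carr P" "\<forall>x\<in>X. (b, x) \<in> point_le P \<mu> h"
      let ?F = "(\<lambda>x. (b, x)) ` X"
      have "?F \<subseteq> point_le P \<mu> h" using b(2) by blast
      then have "(b, a) \<in> congruence P hull ?F"
        using congruenceD(7)[OF cH Xa, of ?F] b(1) hull_subset[of ?F "congruence P"] unfolding is_inf_def by blast
      then show "(b, a) \<in> point_le P \<mu> h"
        using step[of ?F "(b, a)"] b plat_opsD(2)[OF P Xa] by auto
    qed
  qed
qed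

text \<open>Serves to bound a generated congruence of \<open>P\<close> from above by pulling back
  one of \<open>Q\<close>.\<close>

lemma congruence_preimage:
  assumes P: "is_partial_prelattice P" and f: "plat_hom P Q f" and \<theta>: "congruence Q \<theta>"
  shows "congruence P {(x, y) \<in> carr P \<times> carr P. (f x, f y) \<in> \<theta>}" (is "congruence P ?R")
proof (rule congruenceI[OF P])
  have fc: "f x \<in> carr Q" if "x \<in> carr P" for x using f that by (auto simp: plat_hom_def)
  have fl: "(f x, f y) \<in> \<theta>" if "(x, y) \<in> leq P" for x y
    using f that congruenceD(1)[OF \<theta>] by (auto simp: plat_hom_def)
  have l: "leq P \<subseteq> carr P \<times> carr P" using congruenceD(3)[OF congruence_prelattice[OF P]] .
  show "leq P \<subseteq> ?R" using fl l by auto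
  show "?R \<subseteq> carr P \<times> carr P" by auto
  show "trans ?R" using congruenceD(4)[OF \<theta>] by (auto simp: trans_def)
  show "is_sup (carr P) ?R X a" if Xa: "bjoin P X = Some a" for X a
  proof -
    have "is_sup (carr Q) \<theta> (f ` X) (f a)" using f Xa congruenceD(6)[OF \<theta>] by (simp add: plat_hom_def)
    then show ?thesis using plat_opsD(1)[OF P Xa] fc by (auto simp: is_sup_def)
  qed
  show "is_inf (carr P) ?R X a" if Xa: "bmeet P X = Some a" for X a
  proof -
    have "is_inf (carr Q) \<theta> (f ` X) (f a)" using f Xa congruenceD(7)[OF \<theta>] by (simp add: plat_hom_def)
    then show ?thesis using plat_opsD(2)[OF P Xa] fc by (auto simp: is_inf_def)
  qed
qed

lemma Con_c_map_principal:
  assumes P: "is_partial_prelattice P" and Q: "is_partial_prelattice Q" and f: "plat_hom P Q f"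
    and x: "x \<in> carr P" and y: "y \<in> carr P"
  shows "Con_c_map Q f (congruence P hull {(x, y)}) = congruence Q hull {(f x, f y)}"
proof -
  have "f x \<in> carr Q" "f y \<in> carr Q" using f x y by (auto simp: plat_hom_def)
  then have c: "congruence Q (congruence Q hull {(f x, f y)})" by (intro congruence_hull[OF Q]) auto
  have "congruence P hull {(x, y)} \<subseteq> {(u, v) \<in> carr P \<times> carr P. (f u, f v) \<in> congruence Q hull {(f x, f y)}}"
    using x y by (intro congruence_hull_least congruence_preimage[OF P f c]) (auto intro: hull_inc)
  then have "map_prod f f ` (congruence P hull {(x, y)}) \<subseteq> congruence Q hull {(f x, f y)}" by auto
  moreover have "{(f x, f y)} \<subseteq> map_prod f f ` (congruence P hull {(x, y)})"
    by (auto intro!: image_eqI[of _ _ "(x, y)"] hull_inc)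
  ultimately show ?thesis
    unfolding Con_c_map_def by (intro antisym congruence_hull_least[OF c] hull_mono)
qed

section \<open>Finitely based ideals\<close>

text \<open>Only joins are recorded; meets are handled by the same notion on the converse relation.
  The operation is a set of pairs, so that the tables of two structures can be united.\<close>

definition sup_structure :: "'r set \<Rightarrow> 'r rel \<Rightarrow> ('r set \<times> 'r) set \<Rightarrow> bool" where
  "sup_structure R r J \<longleftrightarrow> preorder_on R r \<and>
     (\<forall>X a. (X, a) \<in> J \<longrightarrow> X \<subseteq> R \<and> finite X \<and> X \<noteq> {} \<and> is_sup R r X a)"

lemma sup_structureD:
  assumes "sup_structure R r J"
  shows "r \<subseteq> R \<times> R" "x \<in> R \<Longrightarrow> (x, x) \<in> r" "(x, y) \<in> r \<Longrightarrow> (y, z) \<in> r \<Longrightarrow> (x, z) \<in> r"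
    "(X, a) \<in> J \<Longrightarrow> X \<subseteq> R \<and> finite X \<and> X \<noteq> {} \<and> a \<in> R"
    "(X, a) \<in> J \<Longrightarrow> x \<in> X \<Longrightarrow> (x, a) \<in> r"
    "(X, a) \<in> J \<Longrightarrow> b \<in> R \<Longrightarrow> (\<And>x. x \<in> X \<Longrightarrow> (x, b) \<in> r) \<Longrightarrow> (a, b) \<in> r"
proof -
  show "r \<subseteq> R \<times> R" "x \<in> R \<Longrightarrow> (x, x) \<in> r" "(x, y) \<in> r \<Longrightarrow> (y, z) \<in> r \<Longrightarrow> (x, z) \<in> r"
    using assms by (auto simp: sup_structure_def preorder_on_def refl_on_def dest: transD)
  show "(X, a) \<in> J \<Longrightarrow> X \<subseteq> R \<and> finite X \<and> X \<noteq> {} \<and> a \<in> R" "(X, a) \<in> J \<Longrightarrow> x \<in> X \<Longrightarrow> (x, a) \<in> r"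
    "(X, a) \<in> J \<Longrightarrow> b \<in> R \<Longrightarrow> (\<And>x. x \<in> X \<Longrightarrow> (x, b) \<in> r) \<Longrightarrow> (a, b) \<in> r"
    using assms by (auto simp: sup_structure_def is_sup_def)
qed

text \<open>The empty set may be an ideal, as it should: two generators need not have a common lower
  bound in the partial lattice.\<close>

definition pideal :: "'r rel \<Rightarrow> ('r set \<times> 'r) set \<Rightarrow> 'r set \<Rightarrow> bool" where
  "pideal r J A \<longleftrightarrow> (\<forall>x y. (x, y) \<in> r \<longrightarrow> y \<in> A \<longrightarrow> x \<in> A) \<and> (\<forall>X a. (X, a) \<in> J \<longrightarrow> X \<subseteq> A \<longrightarrow> a \<in> A)"

lemma pidealD:
  assumes "pideal r J A"
  shows "(x, y) \<in> r \<Longrightarrow> y \<in> A \<Longrightarrow> x \<in> A" "(X, a) \<in> J \<Longrightarrow> X \<subseteq> A \<Longrightarrow> a \<in> A"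
  using assms by (auto simp: pideal_def)

lemma pideal_hull: "pideal r J (pideal r J hull A)"
proof (rule hull_in)
  fix T assume "Ball T (pideal r J)"
  then show "pideal r J (\<Inter>T)" unfolding pideal_def by blast
qed

lemma pideal_Int: "pideal r J A \<Longrightarrow> pideal r J B \<Longrightarrow> pideal r J (A \<inter> B)"
  unfolding pideal_def by blast

lemma pideal_carrier: "sup_structure R r J \<Longrightarrow> pideal r J R"
  unfolding pideal_def using sup_structureD(1,4) by fast

lemma pideal_principal:
  assumes "sup_structure R r J" "x \<in> R"
  shows "pideal r J {y. (y, x) \<in> r}"
  unfolding pideal_def using sup_structureD(3,6)[OF assms(1)] assms(2) by blast

text \<open>The elements of the partial lattice that lie below the term in the free lattice;
  \<open>Gen_le_iff\<close> confirms this reading.\<close>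

primrec lower :: "'r rel \<Rightarrow> ('r set \<times> 'r) set \<Rightarrow> 'r lterm \<Rightarrow> 'r set" where
  "lower r J (Gen x) = {y. (y, x) \<in> r}"
| "lower r J (Join s t) = pideal r J hull (lower r J s \<union> lower r J t)"
| "lower r J (Meet s t) = lower r J s \<inter> lower r J t"

lemma lower_ideal:
  assumes "sup_structure R r J" "set_lterm t \<subseteq> R"
  shows "pideal r J (lower r J t) \<and> lower r J t \<subseteq> R"
  using assms(2)
proof (induction t)
  case (Gen x)
  then show ?case using pideal_principal[OF assms(1)] sup_structureD(1)[OF assms(1)] by auto
next
  case (Join s t)
  have "pideal r J hull (lower r J s \<union> lower r J t) \<subseteq> R"
    using Join pideal_carrier[OF assms(1)] by (intro hull_minimal) auto
  then show ?case using pideal_hull by auto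
next
  case (Meet s t)
  then show ?case using pideal_Int by auto
qed

text \<open>The ideal axioms relative to \<open>E\<close>: only deductions with conclusion in
  \<open>E\<close> count. For finite \<open>E\<close> a failure of closure is a finite
  disjunction.\<close>

definition closed_within :: "'r rel \<Rightarrow> ('r set \<times> 'r) set \<Rightarrow> 'r set \<Rightarrow> 'r set \<Rightarrow> bool" where
  "closed_within r J E X \<longleftrightarrow> (\<forall>x\<in>X. \<forall>y\<in>E. (y, x) \<in> r \<longrightarrow> y \<in> X) \<and>
     (\<forall>Y a. (Y, a) \<in> J \<longrightarrow> Y \<subseteq> X \<longrightarrow> a \<in> E \<longrightarrow> a \<in> X)"

text \<open>Balance makes ideals and their intersections finitely computable uniformly in \<open>h\<close>: \<open>E\<close> is a finite
  arena, independent of \<open>h\<close>, that contains everything needed to generate an ideal from \<open>C\<close>. For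
  finite \<open>R\<close> one takes \<open>E = R\<close>, for a lattice the joins (or meets) of members of \<open>C\<close>.\<close>

definition join_balanced :: "'h set \<Rightarrow> 'r set \<Rightarrow> ('h \<Rightarrow> 'r rel) \<Rightarrow> ('r set \<times> 'r) set \<Rightarrow> bool" where
  "join_balanced H R r J \<longleftrightarrow> (\<forall>C. finite C \<and> C \<subseteq> R \<longrightarrow> (\<exists>E. finite E \<and> C \<subseteq> E \<and> E \<subseteq> R \<and>
     (\<forall>h\<in>H. \<forall>X\<subseteq>E. closed_within (r h) J E X \<longrightarrow>
        (\<forall>Y a. (Y, a) \<in> J \<longrightarrow> (\<forall>y\<in>Y. \<exists>x\<in>X. (y, x) \<in> r h) \<longrightarrow> (\<exists>x\<in>X. (a, x) \<in> r h)))))"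

definition meet_balanced :: "'h set \<Rightarrow> 'r set \<Rightarrow> ('h \<Rightarrow> 'r rel) \<Rightarrow> bool" where
  "meet_balanced H R r \<longleftrightarrow> (\<forall>C. finite C \<and> C \<subseteq> R \<longrightarrow> (\<exists>E. finite E \<and> E \<subseteq> R \<and>
     (\<forall>h\<in>H. \<forall>c\<in>C. \<forall>c'\<in>C. \<forall>x. (x, c) \<in> r h \<and> (x, c') \<in> r h \<longrightarrow>
        (\<exists>e\<in>E. (x, e) \<in> r h \<and> (e, c) \<in> r h \<and> (e, c') \<in> r h))))"

text \<open>In the lattice case a nonempty closed \<open>X\<close> has, up to equivalence at
  \<open>h\<close>, a greatest element, the join of \<open>C \<inter> X\<close>, which therefore
  bounds every \<open>a\<close> in question. The arena is built from \<open>J\<close> alone and so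
  is independent of \<open>h\<close>.\<close>

lemma join_balanced_I:
  assumes s: "\<And>h. h \<in> H \<Longrightarrow> sup_structure R (r h) J"
    and fin: "finite R \<or> (\<forall>Y. Y \<subseteq> R \<and> finite Y \<and> Y \<noteq> {} \<longrightarrow> (\<exists>a. (Y, a) \<in> J))"
  shows "join_balanced H R r J"
proof (cases "finite R")
  case True
  show ?thesis
    unfolding join_balanced_def
  proof (intro allI impI exI[of _ R] conjI ballI; (elim conjE)?)
    fix h X Y a
    assume h: "h \<in> H" and CX: "X \<subseteq> R" "closed_within (r h) J R X" and Y: "(Y, a) \<in> J" "\<forall>y\<in>Y. \<exists>x\<in>X. (y, x) \<in> r h"
    note X = CX(1) CX(2)[unfolded closed_within_def, THEN conjunct1] CX(2)[unfolded closed_within_def, THEN conjunct2]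
    have "Y \<subseteq> X" "a \<in> R" using sup_structureD(4)[OF s[OF h] Y(1)] Y(2) X by blast+
    then have "a \<in> X" using X Y by blast
    then show "\<exists>x\<in>X. (a, x) \<in> r h" using sup_structureD(2)[OF s[OF h]] \<open>a \<in> R\<close> by blast
  qed (use True in auto)
next
  case False
  then obtain j where j: "\<And>Y. Y \<subseteq> R \<Longrightarrow> finite Y \<Longrightarrow> Y \<noteq> {} \<Longrightarrow> (Y, j Y) \<in> J" using fin by metis
  show ?thesis
  proof (cases "H = {}")
    case True
    then show ?thesis unfolding join_balanced_def by blast
  next
    case False
    then obtain h0 where h0: "h0 \<in> H" by blast
    show ?thesis
      unfolding join_balanced_def
    proof (intro allI impI; elim conjE)
      fix C assume C: "finite C" "C \<subseteq> R"
      define E where "E = C \<union> j ` (Pow C - {{}})"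
      show "\<exists>E. finite E \<and> C \<subseteq> E \<and> E \<subseteq> R \<and>
       (\<forall>h\<in>H. \<forall>X\<subseteq>E. closed_within (r h) J E X \<longrightarrow>
          (\<forall>Y a. (Y, a) \<in> J \<longrightarrow> (\<forall>y\<in>Y. \<exists>x\<in>X. (y, x) \<in> r h) \<longrightarrow> (\<exists>x\<in>X. (a, x) \<in> r h)))"
      proof (intro exI[of _ E] conjI ballI allI impI; (elim conjE)?)
        show "finite E" "C \<subseteq> E" using C by (auto simp: E_def)
        have jC: "(S, j S) \<in> J" if "S \<subseteq> C" "S \<noteq> {}" for S using that C j[of S] finite_subset by blast
        show "E \<subseteq> R" using C jC sup_structureD(4)[OF s[OF h0]] unfolding E_def by blast
        fix h X Y a
        assume h: "h \<in> H" and CX: "X \<subseteq> E" "closed_within (r h) J E X" and Y: "(Y, a) \<in> J" "\<forall>y\<in>Y. \<exists>x\<in>X. (y, x) \<in> r h"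
        note X = CX(1) CX(2)[unfolded closed_within_def, THEN conjunct1] CX(2)[unfolded closed_within_def, THEN conjunct2]
        note sD = sup_structureD[OF s[OF h]]
        \<comment> \<open>If \<open>x\<close> is a join of a subset \<open>S\<close> of
          \<open>C\<close>, then downward closure within \<open>E\<close> pulls \<open>S\<close>
          into \<open>X\<close>.\<close>
        have rep: "\<exists>S\<subseteq>C \<inter> X. S \<noteq> {} \<and> (x, j S) \<in> r h" if x: "x \<in> X" for x
        proof (cases "x \<in> C")
          case True
          then have "(x, j {x}) \<in> r h" using sD(5)[OF jC, of "{x}" x] by simp
          then show ?thesis using True x by (intro exI[of _ "{x}"]) auto
        next
          case False
          then obtain S where S: "S \<subseteq> C" "S \<noteq> {}" "x = j S" using X(1) x unfolding E_def by blast
          then have "S \<subseteq> X" using sD(5)[OF jC] X(2) x \<open>C \<subseteq> E\<close> by blast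
          moreover have "(x, x) \<in> r h" using sD(2) x X(1) \<open>E \<subseteq> R\<close> by blast
          ultimately show ?thesis using S by blast
        qed
        let ?S = "C \<inter> X"
        have "Y \<noteq> {}" using sD(4)[OF Y(1)] by simp
        then have "?S \<noteq> {}" using rep Y(2) by blast
        then have J: "(?S, j ?S) \<in> J" "j ?S \<in> E" using jC[of ?S] unfolding E_def by auto
        then have "j ?S \<in> X" using X(3) by blast
        moreover have "(a, j ?S) \<in> r h"
        proof (rule sD(6)[OF Y(1)])
          show jR: "j ?S \<in> R" using J(2) \<open>E \<subseteq> R\<close> by blast
          fix y assume "y \<in> Y"
          then obtain x where yx: "x \<in> X" "(y, x) \<in> r h" using Y(2) by blast
          obtain S where x: "S \<subseteq> ?S" "S \<noteq> {}" "(x, j S) \<in> r h" using rep[OF yx(1)] by blast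
          have SJ: "(S, j S) \<in> J" using x jC by blast
          have "(j S, j ?S) \<in> r h" by (rule sD(6)[OF SJ jR]) (use sD(5)[OF J(1)] x(1) in blast)
          then show "(y, j ?S) \<in> r h" using yx(2) x(3) sD(3) by blast
        qed
        ultimately show "\<exists>x\<in>X. (a, x) \<in> r h" by blast
      qed
    qed
  qed
qed

text \<open>In the lattice case the binary meets of members of \<open>C\<close> suffice: although
  the order varies with \<open>h\<close>, the element chosen as meet is an infimum at every
  point.\<close>

lemma meet_balanced_I:
  assumes s: "\<And>h. h \<in> H \<Longrightarrow> sup_structure R (r h) J" "\<And>h. h \<in> H \<Longrightarrow> sup_structure R ((r h)\<inverse>) M"
    and fin: "finite R \<or> (\<forall>Y. Y \<subseteq> R \<and> finite Y \<and> Y \<noteq> {} \<longrightarrow> (\<exists>a. (Y, a) \<in> M))"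
  shows "meet_balanced H R r"
proof (cases "finite R \<or> H = {}")
  case True
  then show ?thesis
  proof
    assume fR: "finite R"
    show ?thesis
      unfolding meet_balanced_def
    proof (intro allI impI exI[of _ R] conjI ballI)
      fix h c c' x assume h: "h \<in> H" and "(x, c) \<in> r h \<and> (x, c') \<in> r h"
      then show "\<exists>e\<in>R. (x, e) \<in> r h \<and> (e, c) \<in> r h \<and> (e, c') \<in> r h"
        using sup_structureD(1,2)[OF s(1)[OF h]] by blast
    qed (use fR in auto)
  qed (auto simp: meet_balanced_def)
next
  case False
  then obtain j h0 where j: "\<And>Y. Y \<subseteq> R \<Longrightarrow> finite Y \<Longrightarrow> Y \<noteq> {} \<Longrightarrow> (Y, j Y) \<in> M" and h0: "h0 \<in> H"
    using fin by (metis ex_in_conv)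
  show ?thesis
    unfolding meet_balanced_def
  proof (intro allI impI; elim conjE)
    fix C assume C: "finite C" "C \<subseteq> R"
    have jC: "({c, c'}, j {c, c'}) \<in> M" if "c \<in> C" "c' \<in> C" for c c' using that C j[of "{c, c'}"] by auto
    let ?E = "(\<lambda>(c, c'). j {c, c'}) ` (C \<times> C)"
    show "\<exists>E. finite E \<and> E \<subseteq> R \<and> (\<forall>h\<in>H. \<forall>c\<in>C. \<forall>c'\<in>C. \<forall>x. (x, c) \<in> r h \<and> (x, c') \<in> r h \<longrightarrow>
        (\<exists>e\<in>E. (x, e) \<in> r h \<and> (e, c) \<in> r h \<and> (e, c') \<in> r h))"
    proof (intro exI[of _ ?E] conjI ballI allI impI; (elim conjE)?)
      show "?E \<subseteq> R" using sup_structureD(4)[OF s(2)[OF h0] jC] by auto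
      fix h c c' x assume h: "h \<in> H" and c: "c \<in> C" "c' \<in> C" and x: "(x, c) \<in> r h" "(x, c') \<in> r h"
      note sD = sup_structureD[OF s(2)[OF h]]
      have "(j {c, c'}, x) \<in> (r h)\<inverse>"
        using x sup_structureD(1)[OF s(1)[OF h]] by (intro sD(6)[OF jC[OF c]]) auto
      moreover have "(c, j {c, c'}) \<in> (r h)\<inverse>" "(c', j {c, c'}) \<in> (r h)\<inverse>"
        using sD(5)[OF jC[OF c]] by auto
      ultimately show "\<exists>e\<in>?E. (x, e) \<in> r h \<and> (e, c) \<in> r h \<and> (e, c') \<in> r h" using c by auto
    qed (use C in auto)
  qed
qed

locale balanced_family =
  fixes R :: "'r set" and r :: "('d::{distrib_lattice, order_bot} \<Rightarrow> bool) \<Rightarrow> 'r rel"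
    and J :: "('r set \<times> 'r) set"
  assumes sup_structure: "h \<in> points \<Longrightarrow> sup_structure R (r h) J"
    and definable_rel: "x \<in> R \<Longrightarrow> y \<in> R \<Longrightarrow> definable (\<lambda>h. (x, y) \<in> r h)"
    and join_balanced: "join_balanced points R r J"
    and meet_balanced: "meet_balanced points R r"
begin

text \<open>The finite \<open>C\<close> is common to all points: \<open>A h\<close> is the union of
  the principal ideals of those members of \<open>C\<close> that lie in it, so a quantifier over
  \<open>A h\<close> can be replaced by one over \<open>C\<close>.\<close>

definition finitely_based :: "(('d \<Rightarrow> bool) \<Rightarrow> 'r set) \<Rightarrow> bool" where
  "finitely_based A \<longleftrightarrow> (\<forall>h\<in>points. pideal (r h) J (A h) \<and> A h \<subseteq> R) \<and> (\<forall>x\<in>R. definable (\<lambda>h. x \<in> A h)) \<and>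
     (\<exists>C. finite C \<and> C \<subseteq> R \<and> (\<forall>h\<in>points. \<forall>x\<in>A h. \<exists>c\<in>C. c \<in> A h \<and> (x, c) \<in> r h))"

lemma finitely_based_principal:
  assumes "x \<in> R" shows "finitely_based (\<lambda>h. {y. (y, x) \<in> r h})"
  unfolding finitely_based_def
proof (intro conjI ballI)
  fix h :: "'d \<Rightarrow> bool" assume "h \<in> points"
  note s = sup_structure[OF this]
  show "pideal (r h) J {y. (y, x) \<in> r h}" "{y. (y, x) \<in> r h} \<subseteq> R"
    using pideal_principal[OF s assms] sup_structureD(1)[OF s] by auto
next
  show "\<exists>C. finite C \<and> C \<subseteq> R \<and> (\<forall>h\<in>points. \<forall>y\<in>{y. (y, x) \<in> r h}. \<exists>c\<in>C. c \<in> {y. (y, x) \<in> r h} \<and> (y, c) \<in> r h)"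
    using sup_structureD(2)[OF sup_structure] assms by (intro exI[of _ "{x}"]) auto
qed (use definable_rel assms in auto)

text \<open>An element of both ideals lies below a \<open>c\<close> and a \<open>c'\<close> from the
  two bases; meet balance interpolates an \<open>e\<close> from a fixed finite set.\<close>

lemma finitely_based_Int:
  assumes A: "finitely_based A" and B: "finitely_based B"
  shows "finitely_based (\<lambda>h. A h \<inter> B h)"
proof -
  have pA: "pideal (r h) J (A h)" "A h \<subseteq> R" and pB: "pideal (r h) J (B h)" "B h \<subseteq> R" if "h \<in> points" for h
    using A B that by (auto simp: finitely_based_def)
  obtain C where C: "finite C" "C \<subseteq> R" "\<And>h x. h \<in> points \<Longrightarrow> x \<in> A h \<Longrightarrow> \<exists>c\<in>C. c \<in> A h \<and> (x, c) \<in> r h"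
    using A unfolding finitely_based_def by blast
  obtain C' where C': "finite C'" "C' \<subseteq> R" "\<And>h x. h \<in> points \<Longrightarrow> x \<in> B h \<Longrightarrow> \<exists>c\<in>C'. c \<in> B h \<and> (x, c) \<in> r h"
    using B unfolding finitely_based_def by blast
  have "finite (C \<union> C') \<and> C \<union> C' \<subseteq> R" using C C' by blast
  then obtain E where E: "finite E" "E \<subseteq> R"
    "\<forall>h\<in>points. \<forall>c\<in>C \<union> C'. \<forall>c'\<in>C \<union> C'. \<forall>x. (x, c) \<in> r h \<and> (x, c') \<in> r h \<longrightarrow>
        (\<exists>e\<in>E. (x, e) \<in> r h \<and> (e, c) \<in> r h \<and> (e, c') \<in> r h)"
    using meet_balanced[unfolded meet_balanced_def, rule_format, of "C \<union> C'"] by (elim exE conjE) metis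
  have "\<exists>e\<in>E. e \<in> A h \<inter> B h \<and> (x, e) \<in> r h" if h: "h \<in> points" and x: "x \<in> A h \<inter> B h" for h x
  proof -
    obtain c c' where c: "c \<in> C" "c \<in> A h" "(x, c) \<in> r h" "c' \<in> C'" "c' \<in> B h" "(x, c') \<in> r h"
      using C(3)[OF h] C'(3)[OF h] x by blast
    then have "\<exists>e\<in>E. (x, e) \<in> r h \<and> (e, c) \<in> r h \<and> (e, c') \<in> r h" using E(3) h by blast
    then show ?thesis using c pidealD(1)[OF pA(1)[OF h]] pidealD(1)[OF pB(1)[OF h]] by blast
  qed
  moreover have "definable (\<lambda>h. x \<in> A h \<inter> B h)" if "x \<in> R" for x
    using A B that definable_conj[of "\<lambda>h. x \<in> A h" "\<lambda>h. x \<in> B h"] by (simp add: finitely_based_def)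
  ultimately show ?thesis
    unfolding finitely_based_def using pA pB pideal_Int E(1,2) by blast
qed

text \<open>Membership in the generated ideal is a finite positive condition: a member of \<open>E\<close> belongs to it
  iff it lies in every \<open>X \<subseteq> E\<close> that is closed at \<open>h\<close>, and "\<open>X\<close> is not closed" is positive in the
  relations \<open>r h\<close>. This replaces an iterative computation of the ideal.\<close>

lemma finitely_based_join:
  assumes A: "finitely_based A" and B: "finitely_based B"
  shows "finitely_based (\<lambda>h. pideal (r h) J hull (A h \<union> B h))"
proof -
  have AR: "A h \<subseteq> R" and BR: "B h \<subseteq> R" if "h \<in> points" for h
    using A B that by (auto simp: finitely_based_def)
  have dA: "definable (\<lambda>h. x \<in> A h)" and dB: "definable (\<lambda>h. x \<in> B h)" if "x \<in> R" for x
    using A B that by (auto simp: finitely_based_def)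
  obtain C where C: "finite C" "C \<subseteq> R" "\<And>h x. h \<in> points \<Longrightarrow> x \<in> A h \<Longrightarrow> \<exists>c\<in>C. c \<in> A h \<and> (x, c) \<in> r h"
    using A unfolding finitely_based_def by blast
  obtain C' where C': "finite C'" "C' \<subseteq> R" "\<And>h x. h \<in> points \<Longrightarrow> x \<in> B h \<Longrightarrow> \<exists>c\<in>C'. c \<in> B h \<and> (x, c) \<in> r h"
    using B unfolding finitely_based_def by blast
  define Z where "Z h = pideal (r h) J hull (A h \<union> B h)" for h
  have "finite (C \<union> C') \<and> C \<union> C' \<subseteq> R" using C C' by blast
  then obtain E where E: "finite E" "C \<union> C' \<subseteq> E" "E \<subseteq> R"
    and bal: "\<And>h X Y a. h \<in> points \<Longrightarrow> X \<subseteq> E \<Longrightarrow> closed_within (r h) J E X \<Longrightarrow> (Y, a) \<in> J \<Longrightarrow>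
       \<forall>y\<in>Y. \<exists>x\<in>X. (y, x) \<in> r h \<Longrightarrow> \<exists>x\<in>X. (a, x) \<in> r h"
    using join_balanced[unfolded join_balanced_def, rule_format, of "C \<union> C'"]
    by (elim exE conjE) metis
  have pZ: "pideal (r h) J (Z h)" for h unfolding Z_def by (rule pideal_hull)
  have ABZ: "A h \<union> B h \<subseteq> Z h" for h unfolding Z_def by (rule hull_subset)
  \<comment> \<open>By balance the down-set of a closed \<open>X\<close> is an ideal; it contains
    the bases of both given ideals, hence everything they generate.\<close>
  have cover: "\<exists>c\<in>X. (x, c) \<in> r h"
    if h: "h \<in> points" and X: "X \<subseteq> E" "closed_within (r h) J E X" "E \<inter> (A h \<union> B h) \<subseteq> X" and x: "x \<in> Z h" for h X x
  proof -
    have "pideal (r h) J {x. \<exists>c\<in>X. (x, c) \<in> r h}"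
      unfolding pideal_def using sup_structureD(3)[OF sup_structure[OF h]] bal[OF h X(1,2)] by blast
    moreover have "A h \<union> B h \<subseteq> {x. \<exists>c\<in>X. (x, c) \<in> r h}"
      using C(3)[OF h] C'(3)[OF h] E(2) X(3) by blast
    ultimately have "Z h \<subseteq> {x. \<exists>c\<in>X. (x, c) \<in> r h}" unfolding Z_def by (rule hull_minimal[rotated])
    then show ?thesis using x by blast
  qed
  have cZ: "closed_within (r h) J E (E \<inter> Z h)" for h unfolding closed_within_def using pidealD[OF pZ] by blast
  have base: "\<exists>c\<in>E. c \<in> Z h \<and> (x, c) \<in> r h" if "h \<in> points" "x \<in> Z h" for h x
    using cover[OF that(1) _ cZ _ that(2)] ABZ[of h] by blast
  have inE: "c \<in> Z h \<longleftrightarrow> (\<forall>X\<in>Pow E. c \<in> X \<or>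
        (\<exists>y\<in>E - X. (y \<in> A h \<or> y \<in> B h) \<or> (\<exists>x\<in>X. (y, x) \<in> r h) \<or> (\<exists>Y. (Y, y) \<in> J \<and> Y \<subseteq> X)))"
    (is "_ \<longleftrightarrow> ?rhs") if h: "h \<in> points" and c: "c \<in> E" for h c
  proof
    assume cz: "c \<in> Z h"
    show ?rhs
    proof (intro ballI disjCI)
      fix X assume X: "X \<in> Pow E" and no: "\<not> (\<exists>y\<in>E - X. (y \<in> A h \<or> y \<in> B h) \<or> (\<exists>x\<in>X. (y, x) \<in> r h) \<or> (\<exists>Y. (Y, y) \<in> J \<and> Y \<subseteq> X))"
      have "closed_within (r h) J E X" "E \<inter> (A h \<union> B h) \<subseteq> X" using no unfolding closed_within_def by blast+
      then show "c \<in> X" using cover[OF h _ _ _ cz, of X] X c unfolding closed_within_def by blast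
    qed
  next
    assume ?rhs
    \<comment> \<open>The instance \<open>X = E \<inter> Z h\<close> is closed, so the alternative
      that asserts a failure of closure is impossible.\<close>
    then have "c \<in> E \<inter> Z h \<or>
        (\<exists>y\<in>E - (E \<inter> Z h). (y \<in> A h \<or> y \<in> B h) \<or> (\<exists>x\<in>E \<inter> Z h. (y, x) \<in> r h) \<or> (\<exists>Y. (Y, y) \<in> J \<and> Y \<subseteq> E \<inter> Z h))"
      by (rule bspec) blast
    then show "c \<in> Z h" using ABZ[of h] cZ[of h] unfolding closed_within_def by blast
  qed
  have defE: "definable (\<lambda>h. c \<in> Z h)" if c: "c \<in> E" for c
  proof -
    \<comment> \<open>The disjuncts about \<open>J\<close> are constant in \<open>h\<close>, since
      \<open>J\<close> is the same at all points.\<close>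
    have "definable (\<lambda>h. \<forall>X\<in>Pow E. c \<in> X \<or>
        (\<exists>y\<in>E - X. (y \<in> A h \<or> y \<in> B h) \<or> (\<exists>x\<in>X. (y, x) \<in> r h) \<or> (\<exists>Y. (Y, y) \<in> J \<and> Y \<subseteq> X)))"
      using E finite_subset[OF _ E(1)]
      by (intro definable_ball definable_bex definable_disj definable_const dA dB definable_rel) auto
    then show ?thesis by (rule iffD2[OF definable_cong, rotated]) (rule inE[OF _ c])
  qed
  have "definable (\<lambda>h. x \<in> Z h)" if x: "x \<in> R" for x
  proof -
    have "definable (\<lambda>h. \<exists>c\<in>E. c \<in> Z h \<and> (x, c) \<in> r h)"
      using E x by (intro definable_bex definable_conj defE definable_rel) auto
    moreover have "x \<in> Z h \<longleftrightarrow> (\<exists>c\<in>E. c \<in> Z h \<and> (x, c) \<in> r h)" if "h \<in> points" for h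
      using base[OF that] pidealD(1)[OF pZ] by blast
    ultimately show ?thesis by (rule iffD2[OF definable_cong, rotated])
  qed
  moreover have "Z h \<subseteq> R" if "h \<in> points" for h
    unfolding Z_def using AR[OF that] BR[OF that] pideal_carrier[OF sup_structure[OF that]]
    by (intro hull_minimal) auto
  ultimately have "finitely_based Z"
    unfolding finitely_based_def using pZ base E(1,3) by (intro conjI ballI exI[of _ E]) auto
  then show ?thesis unfolding Z_def .
qed

lemma finitely_based_lower:
  assumes "set_lterm t \<subseteq> R" shows "finitely_based (\<lambda>h. lower (r h) J t)"
  using assms by (induction t) (auto intro: finitely_based_principal finitely_based_Int finitely_based_join)

end

section \<open>The free lattice over a partial prelattice\<close>

primrec swap :: "'r lterm \<Rightarrow> 'r lterm" where
  "swap (Gen x) = Gen x"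
| "swap (Join s t) = Meet (swap s) (swap t)"
| "swap (Meet s t) = Join (swap s) (swap t)"

lemma set_swap [simp]: "set_lterm (swap t) = set_lterm t"
  by (induction t) auto

text \<open>Ideals of the converse relation are filters, so this is the set of elements above the
  term. Going through \<open>swap\<close> lets results about \<open>lower\<close> apply to
  it.\<close>

definition upper :: "'r rel \<Rightarrow> ('r set \<times> 'r) set \<Rightarrow> 'r lterm \<Rightarrow> 'r set" where
  "upper r M t = lower (r\<inverse>) M (swap t)"

text \<open>The free lattice order over a partial lattice, in Dean's generalisation of Whitman's
  solution of the word problem: \<open>gen\<close> interpolates an element of the partial lattice.\<close>

inductive term_le :: "'r rel \<Rightarrow> ('r set \<times> 'r) set \<Rightarrow> ('r set \<times> 'r) set \<Rightarrow> 'r lterm \<Rightarrow> 'r lterm \<Rightarrow> bool"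
  for r J M where
  gen: "c \<in> upper r M s \<Longrightarrow> c \<in> lower r J t \<Longrightarrow> term_le r J M s t"
| Join_left: "term_le r J M s1 t \<Longrightarrow> term_le r J M s2 t \<Longrightarrow> term_le r J M (Join s1 s2) t"
| Meet_right: "term_le r J M s t1 \<Longrightarrow> term_le r J M s t2 \<Longrightarrow> term_le r J M s (Meet t1 t2)"
| Join_right1: "term_le r J M s t1 \<Longrightarrow> term_le r J M s (Join t1 t2)"
| Join_right2: "term_le r J M s t2 \<Longrightarrow> term_le r J M s (Join t1 t2)"
| Meet_left1: "term_le r J M s1 t \<Longrightarrow> term_le r J M (Meet s1 s2) t"
| Meet_left2: "term_le r J M s2 t \<Longrightarrow> term_le r J M (Meet s1 s2) t"

locale prelattice_structure =
  fixes R :: "'r set" and r J M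
  assumes joins: "sup_structure R r J" and meets: "sup_structure R (r\<inverse>) M"
begin

abbreviation "le \<equiv> term_le r J M"
abbreviation "T \<equiv> {t. set_lterm t \<subseteq> R}"

lemma lower_pideal: "t \<in> T \<Longrightarrow> pideal r J (lower r J t)" "t \<in> T \<Longrightarrow> lower r J t \<subseteq> R"
  using lower_ideal[OF joins] by auto

lemma upper_pideal: "t \<in> T \<Longrightarrow> pideal (r\<inverse>) M (upper r M t)" "t \<in> T \<Longrightarrow> upper r M t \<subseteq> R"
  using lower_ideal[OF meets] by (auto simp: upper_def)

text \<open>The base case of cut elimination: elements below and above the same term are comparable.
  For a join, the principal ideal of an upper element contains both lower sets and hence the ideal
  they generate; meets are dual.\<close>

lemma lower_upper: "t \<in> T \<Longrightarrow> lower r J t \<times> upper r M t \<subseteq> r"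
proof (induction t)
  case (Gen x)
  then show ?case using sup_structureD(3)[OF joins] by (auto simp: upper_def)
next
  case (Join s t)
  have "lower r J (Join s t) \<subseteq> {y. (y, d) \<in> r}" if d: "d \<in> upper r M (Join s t)" for d
  proof -
    have d': "d \<in> upper r M s" "d \<in> upper r M t" "d \<in> R"
      using d Join.prems upper_pideal(2)[of s] by (auto simp: upper_def)
    have "pideal r J {y. (y, d) \<in> r}" by (rule pideal_principal[OF joins d'(3)])
    then show ?thesis using Join d' by (simp, intro hull_minimal) auto
  qed
  then show ?case by auto
next
  case (Meet s t)
  have "upper r M (Meet s t) \<subseteq> {y. (d, y) \<in> r}" if d: "d \<in> lower r J (Meet s t)" for d
  proof -
    have d': "d \<in> lower r J s" "d \<in> lower r J t" "d \<in> R"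
      using d Meet.prems lower_pideal(2)[of s] by auto
    have "pideal (r\<inverse>) M {y. (y, d) \<in> r\<inverse>}" by (rule pideal_principal[OF meets d'(3)])
    then show ?thesis using Meet d' by (simp add: upper_def, intro hull_minimal) (auto simp: upper_def)
  qed
  then show ?case by auto
qed

text \<open>A cut against a generator on the left, obtained by rule induction before general
  transitivity is available. It settles the cuts whose first premise comes from \<open>gen\<close>;
  \<open>upper_antimono\<close> settles those whose second does.\<close>

lemma lower_mono:
  assumes "le s t" "s \<in> T" "t \<in> T" shows "lower r J s \<subseteq> lower r J t"
  using assms
proof (induction rule: term_le.induct)
  case (gen c s t)
  then show ?case using lower_upper[of s] pidealD(1)[OF lower_pideal(1)[of t]] by blast
next
  case (Join_left s1 t s2)
  then show ?case using lower_pideal(1)[of t] by (simp, intro hull_minimal) auto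
next
  case (Join_right1 s t1 t2)
  then show ?case using hull_subset[of "lower r J t1 \<union> lower r J t2" "pideal r J"] by auto
next
  case (Join_right2 s t2 t1)
  then show ?case using hull_subset[of "lower r J t1 \<union> lower r J t2" "pideal r J"] by auto
qed auto

lemma upper_antimono:
  assumes "le s t" "s \<in> T" "t \<in> T" shows "upper r M t \<subseteq> upper r M s"
  using assms
proof (induction rule: term_le.induct)
  case (gen c s t)
  show ?case
  proof
    fix d assume "d \<in> upper r M t"
    then have "(d, c) \<in> r\<inverse>" using lower_upper[of t] gen by auto
    then show "d \<in> upper r M s" using gen pidealD(1)[OF upper_pideal(1)[of s]] by blast
  qed
next
  case (Meet_right s t1 t2)
  then show ?case using upper_pideal(1)[of s] by (simp add: upper_def, intro hull_minimal) (auto simp: upper_def)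
next
  case (Meet_left1 s1 t s2)
  then show ?case using hull_subset[of "upper r M s1 \<union> upper r M s2" "pideal (r\<inverse>) M"]
    by (auto simp: upper_def)
next
  case (Meet_left2 s2 t s1)
  then show ?case using hull_subset[of "upper r M s1 \<union> upper r M s2" "pideal (r\<inverse>) M"]
    by (auto simp: upper_def)
qed (auto simp: upper_def)

lemma term_le_refl: "t \<in> T \<Longrightarrow> le t t"
proof (induction t)
  case (Gen x)
  then have "x \<in> upper r M (Gen x)" "x \<in> lower r J (Gen x)"
    using sup_structureD(2)[OF joins] by (auto simp: upper_def)
  then show ?case by (rule term_le.gen)
qed (auto intro: term_le.intros)

text \<open>Cut elimination: the only new case is a join (or meet) introduced on the right of \<open>s \<le> t\<close>
  and on the left of \<open>t \<le> u\<close>; then the cut moves to a component of \<open>t\<close>.\<close>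

lemma term_le_trans:
  assumes "le s t" "le t u" "s \<in> T" "t \<in> T" "u \<in> T" shows "le s u"
  using assms
proof (induction "size s + size t + size u" arbitrary: s t u rule: less_induct)
  case less
  note IH = less.hyps and st = less.prems(1) and tu = less.prems(2)
  note T = less.prems(3,4,5)
  from st show ?case
  proof cases
    case (gen c)
    then show ?thesis using lower_mono[OF tu] T by (auto intro: term_le.gen)
  next
    case (Join_left s1 s2)
    then show ?thesis using IH[of s1 t u] IH[of s2 t u] tu T by (auto intro!: term_le.Join_left)
  next
    case (Meet_left1 s1 s2)
    then show ?thesis using IH[of s1 t u] tu T by (auto intro!: term_le.Meet_left1)
  next
    case (Meet_left2 s2 s1)
    then show ?thesis using IH[of s2 t u] tu T by (auto intro!: term_le.Meet_left2)
  next
    case t: (Meet_right t1 t2)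
    from tu show ?thesis
    proof cases
      case (gen c)
      then show ?thesis using upper_antimono[OF st] T by (auto intro: term_le.gen)
    next
      case (Meet_right u1 u2)
      then show ?thesis using IH[of s t u1] IH[of s t u2] st T by (auto intro!: term_le.Meet_right)
    next
      case (Join_right1 u1 u2)
      then show ?thesis using IH[of s t u1] st T by (auto intro!: term_le.Join_right1)
    next
      case (Join_right2 u2 u1)
      then show ?thesis using IH[of s t u2] st T by (auto intro!: term_le.Join_right2)
    next
      case (Meet_left1 t1' t2')
      then show ?thesis using IH[of s t1 u] t T by auto
    next
      case (Meet_left2 t2' t1')
      then show ?thesis using IH[of s t2 u] t T by auto
    qed (use t in auto)
  next
    case t: (Join_right1 t1 t2)
    from tu show ?thesis
    proof cases
      case (gen c)
      then show ?thesis using upper_antimono[OF st] T by (auto intro: term_le.gen)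
    next
      case (Meet_right u1 u2)
      then show ?thesis using IH[of s t u1] IH[of s t u2] st T by (auto intro!: term_le.Meet_right)
    next
      case (Join_right1 u1 u2)
      then show ?thesis using IH[of s t u1] st T by (auto intro!: term_le.Join_right1)
    next
      case (Join_right2 u2 u1)
      then show ?thesis using IH[of s t u2] st T by (auto intro!: term_le.Join_right2)
    next
      case (Join_left t1' t2')
      then show ?thesis using IH[of s t1 u] t T by auto
    qed (use t in auto)
  next
    case t: (Join_right2 t2 t1)
    from tu show ?thesis
    proof cases
      case (gen c)
      then show ?thesis using upper_antimono[OF st] T by (auto intro: term_le.gen)
    next
      case (Meet_right u1 u2)
      then show ?thesis using IH[of s t u1] IH[of s t u2] st T by (auto intro!: term_le.Meet_right)
    next
      case (Join_right1 u1 u2)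
      then show ?thesis using IH[of s t u1] st T by (auto intro!: term_le.Join_right1)
    next
      case (Join_right2 u2 u1)
      then show ?thesis using IH[of s t u2] st T by (auto intro!: term_le.Join_right2)
    next
      case (Join_left t1' t2')
      then show ?thesis using IH[of s t2 u] t T by auto
    qed (use t in auto)
  qed
qed

text \<open>With \<open>Gen_le_Gen_iff\<close> this shows that the free lattice adds no relation
  between generators, which is why the given maps can be recovered exactly.\<close>

lemma Gen_le_iff: "x \<in> R \<Longrightarrow> t \<in> T \<Longrightarrow> le (Gen x) t \<longleftrightarrow> x \<in> lower r J t"
proof
  assume x: "x \<in> R" and t: "t \<in> T" and "le (Gen x) t"
  moreover have "x \<in> lower r J (Gen x)" using sup_structureD(2)[OF joins x] by simp
  ultimately show "x \<in> lower r J t" using lower_mono[of "Gen x" t] by auto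
next
  assume x: "x \<in> R" and "t \<in> T" and "x \<in> lower r J t"
  moreover have "x \<in> upper r M (Gen x)" using sup_structureD(2)[OF joins x] by (simp add: upper_def)
  ultimately show "le (Gen x) t" by (intro term_le.gen)
qed

lemma le_Gen_iff: "x \<in> R \<Longrightarrow> t \<in> T \<Longrightarrow> le t (Gen x) \<longleftrightarrow> x \<in> upper r M t"
proof
  assume x: "x \<in> R" and t: "t \<in> T" and "le t (Gen x)"
  moreover have "x \<in> upper r M (Gen x)" using sup_structureD(2)[OF joins x] by (simp add: upper_def)
  ultimately show "x \<in> upper r M t" using upper_antimono[of t "Gen x"] by auto
next
  assume x: "x \<in> R" and "t \<in> T" and "x \<in> upper r M t"
  moreover have "x \<in> lower r J (Gen x)" using sup_structureD(2)[OF joins x] by simp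
  ultimately show "le t (Gen x)" by (intro term_le.gen)
qed

lemma Gen_le_Gen_iff: "x \<in> R \<Longrightarrow> y \<in> R \<Longrightarrow> le (Gen x) (Gen y) \<longleftrightarrow> (x, y) \<in> r"
  by (simp add: Gen_le_iff)

text \<open>Holds because \<open>lower r J t\<close> is closed under the recorded joins; thus these
  remain joins in the free lattice.\<close>

lemma Gen_join_least:
  assumes "(X, a) \<in> J" "t \<in> T" "\<And>x. x \<in> X \<Longrightarrow> le (Gen x) t"
  shows "le (Gen a) t"
  using assms sup_structureD(4)[OF joins assms(1)] Gen_le_iff[OF _ assms(2)]
    pidealD(2)[OF lower_pideal(1)[OF assms(2)] assms(1)] by blast

lemma Gen_meet_greatest:
  assumes "(X, a) \<in> M" "t \<in> T" "\<And>x. x \<in> X \<Longrightarrow> le t (Gen x)"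
  shows "le t (Gen a)"
  using assms sup_structureD(4)[OF meets assms(1)] le_Gen_iff[OF _ assms(2)]
    pidealD(2)[OF upper_pideal(1)[OF assms(2)] assms(1)] by blast

lemma le_Join: "s \<in> T \<Longrightarrow> t \<in> T \<Longrightarrow> le s (Join s t)" "s \<in> T \<Longrightarrow> t \<in> T \<Longrightarrow> le t (Join s t)"
  using term_le_refl by (auto intro: term_le.intros)

lemma Meet_le: "s \<in> T \<Longrightarrow> t \<in> T \<Longrightarrow> le (Meet s t) s" "s \<in> T \<Longrightarrow> t \<in> T \<Longrightarrow> le (Meet s t) t"
  using term_le_refl by (auto intro: term_le.intros)

text \<open>Under the total relation every \<open>lower\<close> and \<open>upper\<close> set
  contains all of \<open>R\<close>, so any element interpolates. Meant for the constant
  point.\<close>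

lemma total_term_le:
  assumes "R \<noteq> {}" "R \<times> R \<subseteq> r" "s \<in> T" "t \<in> T" shows "le s t"
proof -
  have low: "R \<subseteq> lower r J t" if "t \<in> T" for t
    using that
  proof (induction t)
    case (Join s t)
    then show ?case using hull_subset[of "lower r J s \<union> lower r J t" "pideal r J"] by auto
  qed (use assms(2) in auto)
  have up: "R \<subseteq> upper r M t" if "t \<in> T" for t
    using that
  proof (induction t)
    case (Meet s t)
    then show ?case using hull_subset[of "upper r M s \<union> upper r M t" "pideal (r\<inverse>) M"]
      by (auto simp: upper_def)
  qed (use assms(2) in \<open>auto simp: upper_def\<close>)
  obtain x where "x \<in> R" using assms(1) by blast
  then show ?thesis using low[OF assms(4)] up[OF assms(3)] by (intro term_le.gen[of x]) auto
qed

end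

section \<open>Definability of the word problem, uniformly in the point\<close>

locale balanced_structure =
  low: balanced_family R r J + up: balanced_family R "\<lambda>h. (r h)\<inverse>" M
  for R :: "'r set" and r :: "('d::{distrib_lattice, order_bot} \<Rightarrow> bool) \<Rightarrow> 'r rel" and J M
begin

lemma prelattice_structure: "h \<in> points \<Longrightarrow> prelattice_structure R (r h) J M"
  by (intro prelattice_structure.intro low.sup_structure up.sup_structure)

text \<open>An interpolant can be moved up to a member of the finite base of the lower ideal, since
  the upper set is upward closed.\<close>

lemma definable_interpolation:
  assumes s: "set_lterm s \<subseteq> R" and t: "set_lterm t \<subseteq> R"
  shows "definable (\<lambda>h. \<exists>c. c \<in> upper (r h) M s \<and> c \<in> lower (r h) J t)"
proof -
  have A: "up.finitely_based (\<lambda>h. upper (r h) M s)"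
    using up.finitely_based_lower[of "swap s"] s by (simp add: upper_def)
  obtain C where C: "finite C" "C \<subseteq> R"
    "\<And>h x. h \<in> points \<Longrightarrow> x \<in> lower (r h) J t \<Longrightarrow> \<exists>c\<in>C. c \<in> lower (r h) J t \<and> (x, c) \<in> r h"
    using low.finitely_based_lower[OF t] unfolding low.finitely_based_def by blast
  have "definable (\<lambda>h. \<exists>c\<in>C. c \<in> upper (r h) M s \<and> c \<in> lower (r h) J t)"
    using A low.finitely_based_lower[OF t] C(1,2)
    by (intro definable_bex definable_conj) (auto simp: low.finitely_based_def up.finitely_based_def)
  moreover have "(\<exists>c. c \<in> upper (r h) M s \<and> c \<in> lower (r h) J t) \<longleftrightarrow>
      (\<exists>c\<in>C. c \<in> upper (r h) M s \<and> c \<in> lower (r h) J t)" if h: "h \<in> points" for h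
  proof
    assume "\<exists>x. x \<in> upper (r h) M s \<and> x \<in> lower (r h) J t"
    then obtain x where x: "x \<in> upper (r h) M s" "x \<in> lower (r h) J t" by blast
    obtain c where "c \<in> C" "c \<in> lower (r h) J t" "(x, c) \<in> r h" using C(3)[OF h x(2)] by blast
    moreover have "pideal ((r h)\<inverse>) M (upper (r h) M s)" using A h by (simp add: up.finitely_based_def)
    ultimately show "\<exists>c\<in>C. c \<in> upper (r h) M s \<and> c \<in> lower (r h) J t"
      using pidealD(1)[of "(r h)\<inverse>" M "upper (r h) M s" c x] x(1) by auto
  qed blast
  ultimately show ?thesis by (rule iffD2[OF definable_cong, rotated])
qed

text \<open>Read backwards, each rule other than \<open>gen\<close> replaces a term by an immediate
  subterm, so derivability is a finite positive combination of interpolation conditions.\<close>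

lemma definable_term_le:
  assumes "set_lterm s \<subseteq> R" "set_lterm t \<subseteq> R"
  shows "definable (\<lambda>h. term_le (r h) J M s t)"
  using assms
proof (induction "size s + size t" arbitrary: s t rule: less_induct)
  case less
  \<comment> \<open>\<open>p1\<close> collects the rules acting on the left term, \<open>p2\<close>
    those acting on the right one.\<close>
  define p1 where "p1 h = (case s of Join s1 s2 \<Rightarrow> term_le (r h) J M s1 t \<and> term_le (r h) J M s2 t
    | Meet s1 s2 \<Rightarrow> term_le (r h) J M s1 t \<or> term_le (r h) J M s2 t | Gen _ \<Rightarrow> False)" for h
  define p2 where "p2 h = (case t of Meet t1 t2 \<Rightarrow> term_le (r h) J M s t1 \<and> term_le (r h) J M s t2
    | Join t1 t2 \<Rightarrow> term_le (r h) J M s t1 \<or> term_le (r h) J M s t2 | Gen _ \<Rightarrow> False)" for h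
  have "definable p1"
    using less unfolding p1_def by (cases s) (auto intro!: definable_conj definable_disj definable_const)
  moreover have "definable p2"
    using less unfolding p2_def by (cases t) (auto intro!: definable_conj definable_disj definable_const)
  ultimately have "definable (\<lambda>h. (\<exists>c. c \<in> upper (r h) M s \<and> c \<in> lower (r h) J t) \<or> p1 h \<or> p2 h)"
    using definable_interpolation less.prems by (intro definable_disj)
  moreover have "term_le (r h) J M s t \<longleftrightarrow>
      (\<exists>c. c \<in> upper (r h) M s \<and> c \<in> lower (r h) J t) \<or> p1 h \<or> p2 h" for h
  proof
    show "term_le (r h) J M s t \<Longrightarrow> (\<exists>c. c \<in> upper (r h) M s \<and> c \<in> lower (r h) J t) \<or> p1 h \<or> p2 h"
      unfolding p1_def p2_def by (cases rule: term_le.cases) auto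
    show "(\<exists>c. c \<in> upper (r h) M s \<and> c \<in> lower (r h) J t) \<or> p1 h \<or> p2 h \<Longrightarrow> term_le (r h) J M s t"
      unfolding p1_def p2_def by (auto intro: term_le.intros split: lterm.splits)
  qed
  ultimately show ?case by simp
qed

end

section \<open>Gluing two families along a finite lattice\<close>

text \<open>\<open>N\<close> stands for \<open>K\<close>, as the set of pairs of images of its
  elements. It is a relation because neither homomorphism need be injective. \<open>N_embed\<close>
  says that both sides induce the same preorder on \<open>K\<close> at each point.\<close>

locale amalgam =
  fixes U V :: "'r set" and u v :: "('d::{distrib_lattice, order_bot} \<Rightarrow> bool) \<Rightarrow> 'r rel"
    and JU JV MU MV :: "('r set \<times> 'r) set" and N :: "'r rel"
  assumes disjoint: "U \<inter> V = {}"
    and U_joins: "h \<in> points \<Longrightarrow> sup_structure U (u h) JU"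
    and U_meets: "h \<in> points \<Longrightarrow> sup_structure U ((u h)\<inverse>) MU"
    and V_joins: "h \<in> points \<Longrightarrow> sup_structure V (v h) JV"
    and V_meets: "h \<in> points \<Longrightarrow> sup_structure V ((v h)\<inverse>) MV"
    and U_def: "x \<in> U \<Longrightarrow> y \<in> U \<Longrightarrow> definable (\<lambda>h. (x, y) \<in> u h)"
    and V_def: "x \<in> V \<Longrightarrow> y \<in> V \<Longrightarrow> definable (\<lambda>h. (x, y) \<in> v h)"
    and U_fin: "finite U \<or> (\<forall>Y. Y \<subseteq> U \<and> finite Y \<and> Y \<noteq> {} \<longrightarrow> (\<exists>a. (Y, a) \<in> JU) \<and> (\<exists>a. (Y, a) \<in> MU))"
    and V_fin: "finite V \<or> (\<forall>Y. Y \<subseteq> V \<and> finite Y \<and> Y \<noteq> {} \<longrightarrow> (\<exists>a. (Y, a) \<in> JV) \<and> (\<exists>a. (Y, a) \<in> MV))"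
    and N: "finite N" "N \<subseteq> U \<times> V"
    and N_embed: "h \<in> points \<Longrightarrow> (a, b) \<in> N \<Longrightarrow> (a', b') \<in> N \<Longrightarrow> (a, a') \<in> u h \<longleftrightarrow> (b, b') \<in> v h"
    and N_join: "Y \<subseteq> N \<Longrightarrow> finite Y \<Longrightarrow> Y \<noteq> {} \<Longrightarrow> \<exists>(a, b)\<in>N. (fst ` Y, a) \<in> JU \<and> (snd ` Y, b) \<in> JV"
    and N_meet: "Y \<subseteq> N \<Longrightarrow> finite Y \<Longrightarrow> Y \<noteq> {} \<Longrightarrow> \<exists>(a, b)\<in>N. (fst ` Y, a) \<in> MU \<and> (snd ` Y, b) \<in> MV"
begin

text \<open>One crossing through \<open>N\<close> suffices: by \<open>N_embed\<close> a path that
  crosses over and back can be replaced by one that stays on its side.\<close>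

definition glue :: "('d \<Rightarrow> bool) \<Rightarrow> 'r rel" where
  "glue h = u h \<union> v h \<union> (u h O N O v h) \<union> (v h O N\<inverse> O u h)"

text \<open>\<open>dual\<close> and \<open>swapped\<close> express the symmetries of the situation,
  so that proofs done for joins and for \<open>U\<close> also serve meets and
  \<open>V\<close>.\<close>

lemma dual: "amalgam U V (\<lambda>h. (u h)\<inverse>) (\<lambda>h. (v h)\<inverse>) MU MV JU JV N"
proof
  show "h \<in> points \<Longrightarrow> (a, b) \<in> N \<Longrightarrow> (a', b') \<in> N \<Longrightarrow> (a, a') \<in> (u h)\<inverse> \<longleftrightarrow> (b, b') \<in> (v h)\<inverse>" for h a b a' b'
    using N_embed by auto
  show "finite U \<or> (\<forall>Y. Y \<subseteq> U \<and> finite Y \<and> Y \<noteq> {} \<longrightarrow> (\<exists>a. (Y, a) \<in> MU) \<and> (\<exists>a. (Y, a) \<in> JU))"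
    using U_fin by blast
  show "finite V \<or> (\<forall>Y. Y \<subseteq> V \<and> finite Y \<and> Y \<noteq> {} \<longrightarrow> (\<exists>a. (Y, a) \<in> MV) \<and> (\<exists>a. (Y, a) \<in> JV))"
    using V_fin by blast
qed (use disjoint U_joins U_meets V_joins V_meets U_def V_def N N_join N_meet in auto)

lemma swapped: "amalgam V U v u JV JU MV MU (N\<inverse>)"
proof
  have flip: "fst ` Y = snd ` Y\<inverse>" "snd ` Y = fst ` Y\<inverse>" for Y :: "'r rel" by force+
  show "\<exists>(a, b)\<in>N\<inverse>. (fst ` Y, a) \<in> JV \<and> (snd ` Y, b) \<in> JU" if "Y \<subseteq> N\<inverse>" "finite Y" "Y \<noteq> {}" for Y
  proof -
    have "Y\<inverse> \<subseteq> N" "finite (Y\<inverse>)" "Y\<inverse> \<noteq> {}" using that by auto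
    then show ?thesis using N_join[of "Y\<inverse>"] unfolding flip[of Y] by auto
  qed
  show "\<exists>(a, b)\<in>N\<inverse>. (fst ` Y, a) \<in> MV \<and> (snd ` Y, b) \<in> MU" if "Y \<subseteq> N\<inverse>" "finite Y" "Y \<noteq> {}" for Y
  proof -
    have "Y\<inverse> \<subseteq> N" "finite (Y\<inverse>)" "Y\<inverse> \<noteq> {}" using that by auto
    then show ?thesis using N_meet[of "Y\<inverse>"] unfolding flip[of Y] by auto
  qed
  show "h \<in> points \<Longrightarrow> (a, b) \<in> N\<inverse> \<Longrightarrow> (a', b') \<in> N\<inverse> \<Longrightarrow> (a, a') \<in> v h \<longleftrightarrow> (b, b') \<in> u h" for h a b a' b'
    using N_embed by blast
qed (use disjoint U_joins U_meets V_joins V_meets U_def V_def U_fin V_fin N in auto)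

lemma glue_swapped: "amalgam.glue v u (N\<inverse>) = glue"
  by (auto simp: fun_eq_iff glue_def amalgam.glue_def[OF swapped])

lemma glue_dual: "amalgam.glue (\<lambda>h. (u h)\<inverse>) (\<lambda>h. (v h)\<inverse>) N = (\<lambda>h. (glue h)\<inverse>)"
  by (auto simp: fun_eq_iff glue_def amalgam.glue_def[OF dual])

context
  fixes h :: "'d \<Rightarrow> bool"
  assumes h: "h \<in> points"
begin

lemmas uD = sup_structureD[OF U_joins[OF h]]
lemmas vD = sup_structureD[OF V_joins[OF h]]

lemma glue_UU: "x \<in> U \<Longrightarrow> y \<in> U \<Longrightarrow> (x, y) \<in> glue h \<longleftrightarrow> (x, y) \<in> u h"
  using uD(1) vD(1) N(2) disjoint unfolding glue_def by blast

lemma glue_UV: "x \<in> U \<Longrightarrow> y \<in> V \<Longrightarrow> (x, y) \<in> glue h \<longleftrightarrow> (\<exists>(a, b)\<in>N. (x, a) \<in> u h \<and> (b, y) \<in> v h)"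
  using uD(1) vD(1) N(2) disjoint unfolding glue_def by blast

lemma glue_carrier: "glue h \<subseteq> (U \<union> V) \<times> (U \<union> V)"
  using uD(1) vD(1) unfolding glue_def by blast

lemma glue_N: "(a, b) \<in> N \<Longrightarrow> (a, b) \<in> glue h \<and> (b, a) \<in> glue h"
  using uD(2) vD(2) N(2) unfolding glue_def by blast

end

lemma glue_VV: "h \<in> points \<Longrightarrow> x \<in> V \<Longrightarrow> y \<in> V \<Longrightarrow> (x, y) \<in> glue h \<longleftrightarrow> (x, y) \<in> v h"
  using amalgam.glue_UU[OF swapped] glue_swapped by simp

lemma glue_VU: "h \<in> points \<Longrightarrow> x \<in> V \<Longrightarrow> y \<in> U \<Longrightarrow> (x, y) \<in> glue h \<longleftrightarrow> (\<exists>(a, b)\<in>N. (x, b) \<in> v h \<and> (a, y) \<in> u h)"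
  using amalgam.glue_UV[OF swapped] glue_swapped by auto

text \<open>The case with content is \<open>VU\<close>, a round trip through \<open>V\<close>: the
  part inside \<open>V\<close> joins two second components of \<open>N\<close>, and
  \<open>N_embed\<close> carries it back to \<open>U\<close>.\<close>

lemma glue_trans_U:
  assumes h: "h \<in> points" and xy: "(x, y) \<in> glue h" and yz: "(y, z) \<in> glue h" and x: "x \<in> U"
  shows "(x, z) \<in> glue h"
proof -
  note uT = sup_structureD(3)[OF U_joins[OF h]] and vT = sup_structureD(3)[OF V_joins[OF h]]
  have yz': "y \<in> U \<union> V" "z \<in> U \<union> V" using glue_carrier[OF h] xy yz by auto
  consider (UU) "y \<in> U" "z \<in> U" | (UV) "y \<in> U" "z \<in> V" | (VU) "y \<in> V" "z \<in> U" | (VV) "y \<in> V" "z \<in> V"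
    using yz' by blast
  then show ?thesis
  proof cases
    case UU
    then show ?thesis using xy yz x uT[of x y z] by (simp add: glue_UU[OF h])
  next
    case UV
    then have "(x, y) \<in> u h" using xy x glue_UU[OF h] by simp
    moreover obtain a b where "(a, b) \<in> N" "(y, a) \<in> u h" "(b, z) \<in> v h"
      using yz UV glue_UV[OF h] by blast
    ultimately show ?thesis unfolding glue_UV[OF h x UV(2)] using uT by blast
  next
    case VV
    then have "(y, z) \<in> v h" using yz glue_VV[OF h] by simp
    moreover obtain a b where "(a, b) \<in> N" "(x, a) \<in> u h" "(b, y) \<in> v h"
      using xy x VV glue_UV[OF h] by blast
    ultimately show ?thesis unfolding glue_UV[OF h x VV(2)] using vT by blast
  next
    case VU
    obtain a b where ab: "(a, b) \<in> N" "(x, a) \<in> u h" "(b, y) \<in> v h"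
      using xy x VU glue_UV[OF h] by blast
    obtain a' b' where ab': "(a', b') \<in> N" "(y, b') \<in> v h" "(a', z) \<in> u h"
      using yz VU glue_VU[OF h] by blast
    have "(b, b') \<in> v h" using ab ab' vT by blast
    then have "(a, a') \<in> u h" using N_embed[OF h ab(1) ab'(1)] by simp
    then have "(x, z) \<in> u h" using ab ab' uT by blast
    then show ?thesis using glue_UU[OF h x VU(2)] by simp
  qed
qed

text \<open>An upper bound in \<open>V\<close> may be reached from each member of \<open>X\<close>
  by a different crossing. As \<open>N\<close> is closed under joins, the finitely many crossings
  can be merged into one, through which the supremum passes too.\<close>

lemma glue_sup_U:
  assumes h: "h \<in> points" and Xa: "(X, a) \<in> JU"
  shows "X \<subseteq> U \<union> V \<and> finite X \<and> X \<noteq> {} \<and> is_sup (U \<union> V) (glue h) X a"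
proof -
  note uD = sup_structureD[OF U_joins[OF h]] and vD = sup_structureD[OF V_joins[OF h]]
  have X: "X \<subseteq> U" "finite X" "X \<noteq> {}" "a \<in> U" using uD(4)[OF Xa] by auto
  have "(a, b) \<in> glue h" if b: "b \<in> U \<union> V" and ub: "\<And>x. x \<in> X \<Longrightarrow> (x, b) \<in> glue h" for b
  proof (cases "b \<in> U")
    case True
    then have "(a, b) \<in> u h" using ub X(1) glue_UU[OF h _ True] by (intro uD(6)[OF Xa]) auto
    then show ?thesis by (simp add: glue_def)
  next
    case False
    then have bV: "b \<in> V" using b by simp
    have "\<exists>n\<in>N. (x, fst n) \<in> u h \<and> (snd n, b) \<in> v h" if "x \<in> X" for x
      using ub[OF that] unfolding glue_UV[OF h subsetD[OF X(1) that] bV] by (simp add: case_prod_unfold)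
    then obtain k where k: "\<And>x. x \<in> X \<Longrightarrow> k x \<in> N \<and> (x, fst (k x)) \<in> u h \<and> (snd (k x), b) \<in> v h"
      by metis
    obtain c d where cd: "(c, d) \<in> N" "(fst ` k ` X, c) \<in> JU" "(snd ` k ` X, d) \<in> JV"
      using N_join[of "k ` X"] X k by auto
    have dV: "d \<in> V" and cU: "c \<in> U" using cd(1) N(2) by auto
    have "(a, c) \<in> u h" using uD(5)[OF cd(2)] uD(3) k by (intro uD(6)[OF Xa cU]) blast
    moreover have "(d, b) \<in> v h" using k by (intro vD(6)[OF cd(3) bV]) auto
    ultimately show ?thesis using glue_UV[OF h X(4) bV] cd(1) by blast
  qed
  then show ?thesis using X uD(5)[OF Xa] unfolding is_sup_def by (auto simp: glue_def)
qed

lemma glue_sup_structure: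
  assumes h: "h \<in> points" shows "sup_structure (U \<union> V) (glue h) (JU \<union> JV)"
  unfolding sup_structure_def
proof (intro conjI allI impI)
  have refl: "(x, x) \<in> glue h" if "x \<in> U \<union> V" for x
    using that sup_structureD(2)[OF U_joins[OF h]] sup_structureD(2)[OF V_joins[OF h]]
    unfolding glue_def by blast
  have "trans (glue h)"
  proof (rule transI)
    fix x y z assume a: "(x, y) \<in> glue h" "(y, z) \<in> glue h"
    then have "x \<in> U \<or> x \<in> V" using glue_carrier[OF h] by auto
    then show "(x, z) \<in> glue h"
      using glue_trans_U[OF h a] amalgam.glue_trans_U[OF swapped h, unfolded glue_swapped, OF a] by blast
  qed
  then show "preorder_on (U \<union> V) (glue h)"
    using refl glue_carrier[OF h] by (auto simp: preorder_on_def refl_on_def)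
  fix X a assume "(X, a) \<in> JU \<union> JV"
  then have "X \<subseteq> U \<union> V \<and> finite X \<and> X \<noteq> {} \<and> is_sup (U \<union> V) (glue h) X a"
    using glue_sup_U[OF h, of X a] amalgam.glue_sup_U[OF swapped h, of X a]
    unfolding glue_swapped Un_commute[of V U] by blast
  then show "X \<subseteq> U \<union> V" "finite X" "X \<noteq> {}" "is_sup (U \<union> V) (glue h) X a" by auto
qed

section \<open>Definability and balance of the glued relation\<close>

lemma definable_glue_U:
  assumes x: "x \<in> U" and y: "y \<in> U \<union> V"
  shows "definable (\<lambda>h. (x, y) \<in> glue h)"
proof (cases "y \<in> U")
  case True
  show ?thesis by (rule iffD2[OF definable_cong U_def[OF x True]]) (rule glue_UU[OF _ x True])
next
  case False
  then have yV: "y \<in> V" using y by simp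
  have "definable (\<lambda>h. \<exists>n\<in>N. (x, fst n) \<in> u h \<and> (snd n, y) \<in> v h)"
    using N by (intro definable_bex definable_conj U_def V_def x yV) auto
  then show ?thesis
    by (rule iffD2[OF definable_cong, rotated]) (simp add: glue_UV[OF _ x yV] case_prod_unfold)
qed

text \<open>The two components interact only through \<open>N\<close>, so it suffices to add the two projections of \<open>N\<close>
  to the sets being balanced.\<close>

lemma glue_join_balanced: "join_balanced points (U \<union> V) glue (JU \<union> JV)"
  unfolding join_balanced_def
proof (intro allI impI; elim conjE)
  fix C assume C: "finite C" "C \<subseteq> U \<union> V"
  have bU: "join_balanced points U u JU" using U_joins U_fin by (intro join_balanced_I) auto
  have bV: "join_balanced points V v JV" using V_joins V_fin by (intro join_balanced_I) auto
  have fU: "finite (C \<inter> U \<union> fst ` N)" "C \<inter> U \<union> fst ` N \<subseteq> U"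
    and fV: "finite (C \<inter> V \<union> snd ` N)" "C \<inter> V \<union> snd ` N \<subseteq> V" using C N by auto
  obtain EU where EU: "finite EU" "C \<inter> U \<union> fst ` N \<subseteq> EU" "EU \<subseteq> U" and
    EU': "\<forall>h\<in>points. \<forall>X\<subseteq>EU. closed_within (u h) JU EU X \<longrightarrow>
      (\<forall>Y a. (Y, a) \<in> JU \<longrightarrow> (\<forall>y\<in>Y. \<exists>x\<in>X. (y, x) \<in> u h) \<longrightarrow> (\<exists>x\<in>X. (a, x) \<in> u h))"
    using bU[unfolded join_balanced_def, rule_format, OF conjI, OF fU] by (elim exE conjE)
  obtain EV where EV: "finite EV" "C \<inter> V \<union> snd ` N \<subseteq> EV" "EV \<subseteq> V" and
    EV': "\<forall>h\<in>points. \<forall>X\<subseteq>EV. closed_within (v h) JV EV X \<longrightarrow>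
      (\<forall>Y a. (Y, a) \<in> JV \<longrightarrow> (\<forall>y\<in>Y. \<exists>x\<in>X. (y, x) \<in> v h) \<longrightarrow> (\<exists>x\<in>X. (a, x) \<in> v h))"
    using bV[unfolded join_balanced_def, rule_format, OF conjI, OF fV] by (elim exE conjE)
  let ?E = "EU \<union> EV"
  show "\<exists>E. finite E \<and> C \<subseteq> E \<and> E \<subseteq> U \<union> V \<and>
     (\<forall>h\<in>points. \<forall>X\<subseteq>E. closed_within (glue h) (JU \<union> JV) E X \<longrightarrow>
        (\<forall>Y a. (Y, a) \<in> JU \<union> JV \<longrightarrow> (\<forall>y\<in>Y. \<exists>x\<in>X. (y, x) \<in> glue h) \<longrightarrow> (\<exists>x\<in>X. (a, x) \<in> glue h)))"
  proof (intro exI[of _ ?E] conjI ballI allI impI)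
    fix h X Y a
    assume h: "h \<in> points" and XE: "X \<subseteq> ?E" and cl: "closed_within (glue h) (JU \<union> JV) ?E X"
      and Ya: "(Y, a) \<in> JU \<union> JV" and Y: "\<forall>y\<in>Y. \<exists>x\<in>X. (y, x) \<in> glue h"
    have down: "y \<in> X" if "x \<in> X" "y \<in> ?E" "(y, x) \<in> glue h" for x y
      using cl that unfolding closed_within_def by blast
    have join: "b \<in> X" if "(Z, b) \<in> JU \<union> JV" "Z \<subseteq> X" "b \<in> ?E" for Z b
      using cl that unfolding closed_within_def by blast
    from Ya show "\<exists>x\<in>X. (a, x) \<in> glue h"
    proof
      assume Ya: "(Y, a) \<in> JU"
      have YU: "Y \<subseteq> U" using sup_structureD(4)[OF U_joins[OF h] Ya] by simp
      have "closed_within (u h) JU EU (X \<inter> U)"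
        unfolding closed_within_def
      proof (intro conjI ballI allI impI)
        show "y \<in> X \<inter> U" if "x \<in> X \<inter> U" "y \<in> EU" "(y, x) \<in> u h" for x y
          using that down[of x y] EU(3) by (auto simp: glue_def)
        show "b \<in> X \<inter> U" if "(Z, b) \<in> JU" "Z \<subseteq> X \<inter> U" "b \<in> EU" for Z b
          using that join[of Z b] EU(3) by auto
      qed
      moreover have "X \<inter> U \<subseteq> EU" using XE EV(3) disjoint by blast
      moreover have "\<exists>x\<in>X \<inter> U. (y, x) \<in> u h" if y: "y \<in> Y" for y
      proof -
        obtain x where x: "x \<in> X" "(y, x) \<in> glue h" using Y y by blast
        show ?thesis
        proof (cases "x \<in> U")
          case True
          then show ?thesis using x y YU glue_UU[OF h] by blast
        next
          case False
          then have xV: "x \<in> V" using x XE EU(3) EV(3) by blast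
          obtain n m where nm: "(n, m) \<in> N" "(y, n) \<in> u h" "(m, x) \<in> v h"
            using glue_UV[OF h _ xV] x y YU by blast
          \<comment> \<open>The arena contains the projection of \<open>N\<close>, so the crossing
            point is in it; lying below \<open>x\<close>, it belongs to \<open>X\<close> and covers
            \<open>y\<close> inside \<open>U\<close>.\<close>
          have nE: "n \<in> EU" and nU: "n \<in> U" using nm(1) EU N(2) by force+
          have "(n, x) \<in> glue h"
            using nm glue_UV[OF h nU xV] sup_structureD(2)[OF U_joins[OF h] nU] by blast
          then have "n \<in> X" using down[OF x(1)] nE by blast
          then show ?thesis using nm(2) nU by blast
        qed
      qed
      ultimately have "\<exists>x\<in>X \<inter> U. (a, x) \<in> u h" by (intro EU'[rule_format, OF h _ _ Ya])
      then show ?thesis by (auto simp: glue_def)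
    next
      assume Ya: "(Y, a) \<in> JV"
      have YV: "Y \<subseteq> V" using sup_structureD(4)[OF V_joins[OF h] Ya] by simp
      have "closed_within (v h) JV EV (X \<inter> V)"
        unfolding closed_within_def
      proof (intro conjI ballI allI impI)
        show "y \<in> X \<inter> V" if "x \<in> X \<inter> V" "y \<in> EV" "(y, x) \<in> v h" for x y
          using that down[of x y] EV(3) by (auto simp: glue_def)
        show "b \<in> X \<inter> V" if "(Z, b) \<in> JV" "Z \<subseteq> X \<inter> V" "b \<in> EV" for Z b
          using that join[of Z b] EV(3) by auto
      qed
      moreover have "X \<inter> V \<subseteq> EV" using XE EU(3) disjoint by blast
      moreover have "\<exists>x\<in>X \<inter> V. (y, x) \<in> v h" if y: "y \<in> Y" for y
      proof -
        obtain x where x: "x \<in> X" "(y, x) \<in> glue h" using Y y by blast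
        show ?thesis
        proof (cases "x \<in> V")
          case True
          then show ?thesis using x y YV glue_VV[OF h] by blast
        next
          case False
          then have xU: "x \<in> U" using x XE EU(3) EV(3) by blast
          obtain n m where nm: "(n, m) \<in> N" "(y, m) \<in> v h" "(n, x) \<in> u h"
            using glue_VU[OF h _ xU] x y YV by blast
          have mE: "m \<in> EV" and mV: "m \<in> V" using nm(1) EV N(2) by force+
          have "(m, x) \<in> glue h"
            using nm glue_VU[OF h mV xU] sup_structureD(2)[OF V_joins[OF h] mV] by blast
          then have "m \<in> X" using down[OF x(1)] mE by blast
          then show ?thesis using nm(2) mV by blast
        qed
      qed
      ultimately have "\<exists>x\<in>X \<inter> V. (a, x) \<in> v h" by (intro EV'[rule_format, OF h _ _ Ya])
      then show ?thesis by (auto simp: glue_def)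
    qed
  qed (use C EU EV in auto)
qed

text \<open>For \<open>x\<close> in \<open>U\<close>, each bound in \<open>C\<close> can be lowered
  to an element of \<open>C \<inter> U\<close> or a first component of \<open>N\<close> that still
  lies above \<open>x\<close>. Balance of \<open>U\<close> then supplies the interpolant.\<close>

lemma meet_balanced_U:
  assumes C: "finite C" "C \<subseteq> U \<union> V"
  shows "\<exists>E. finite E \<and> E \<subseteq> U \<union> V \<and> (\<forall>h\<in>points. \<forall>c\<in>C. \<forall>c'\<in>C. \<forall>x\<in>U. (x, c) \<in> glue h \<and> (x, c') \<in> glue h \<longrightarrow>
        (\<exists>e\<in>E. (x, e) \<in> glue h \<and> (e, c) \<in> glue h \<and> (e, c') \<in> glue h))"
proof -
  have b: "meet_balanced points U u" by (rule meet_balanced_I[OF U_joins U_meets]) (use U_fin in auto)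
  let ?C = "C \<inter> U \<union> fst ` N"
  have fC: "finite ?C" "?C \<subseteq> U" using C N by auto
  obtain E where E: "finite E" "E \<subseteq> U" and
    bal: "\<forall>h\<in>points. \<forall>c\<in>?C. \<forall>c'\<in>?C. \<forall>x. (x, c) \<in> u h \<and> (x, c') \<in> u h \<longrightarrow>
        (\<exists>e\<in>E. (x, e) \<in> u h \<and> (e, c) \<in> u h \<and> (e, c') \<in> u h)"
    using b[unfolded meet_balanced_def, rule_format, OF conjI, OF fC] by (elim exE conjE)
  show ?thesis
  proof (intro exI[of _ E] conjI ballI impI; (elim conjE)?)
    fix h c c' x
    assume h: "h \<in> points" and c: "c \<in> C" "c' \<in> C" and x: "x \<in> U" "(x, c) \<in> glue h" "(x, c') \<in> glue h"
    have proj: "\<exists>d\<in>?C. (x, d) \<in> u h \<and> (d, b) \<in> glue h" if b: "b \<in> C" "(x, b) \<in> glue h" for b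
    proof (cases "b \<in> U")
      case True
      then have "(b, b) \<in> glue h" using sup_structureD(2)[OF U_joins[OF h]] by (simp add: glue_def)
      then show ?thesis using b True glue_UU[OF h x(1)] by blast
    next
      case False
      then have bV: "b \<in> V" using b C by blast
      obtain n m where nm: "(n, m) \<in> N" "(x, n) \<in> u h" "(m, b) \<in> v h"
        using b glue_UV[OF h x(1) bV] by blast
      then have nU: "n \<in> U" using N(2) by auto
      have "(n, b) \<in> glue h"
        using nm glue_UV[OF h nU bV] sup_structureD(2)[OF U_joins[OF h] nU] by blast
      moreover have "n \<in> ?C" using nm(1) by force
      ultimately show ?thesis using nm(2) by blast
    qed
    obtain d d' where d: "d \<in> ?C" "(x, d) \<in> u h" "(d, c) \<in> glue h" "d' \<in> ?C" "(x, d') \<in> u h" "(d', c') \<in> glue h"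
      using proj[OF c(1) x(2)] proj[OF c(2) x(3)] by blast
    then obtain e where "e \<in> E" "(x, e) \<in> u h" "(e, d) \<in> u h" "(e, d') \<in> u h" using bal h by blast
    moreover have "u h \<subseteq> glue h" by (auto simp: glue_def)
    ultimately show "\<exists>e\<in>E. (x, e) \<in> glue h \<and> (e, c) \<in> glue h \<and> (e, c') \<in> glue h"
      using d sup_structureD(3)[OF glue_sup_structure[OF h]] by blast
  qed (use E in auto)
qed

lemma glue_meet_balanced: "meet_balanced points (U \<union> V) glue"
  unfolding meet_balanced_def
proof (intro allI impI; elim conjE)
  fix C assume C: "finite C" "C \<subseteq> U \<union> V"
  obtain E where E: "finite E" "E \<subseteq> U \<union> V"
    "\<forall>h\<in>points. \<forall>c\<in>C. \<forall>c'\<in>C. \<forall>x\<in>U. (x, c) \<in> glue h \<and> (x, c') \<in> glue h \<longrightarrow>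
        (\<exists>e\<in>E. (x, e) \<in> glue h \<and> (e, c) \<in> glue h \<and> (e, c') \<in> glue h)"
    using meet_balanced_U[OF C] by (elim exE conjE)
  have C': "C \<subseteq> V \<union> U" using C by auto
  obtain E' where E': "finite E'" "E' \<subseteq> V \<union> U"
    "\<forall>h\<in>points. \<forall>c\<in>C. \<forall>c'\<in>C. \<forall>x\<in>V. (x, c) \<in> glue h \<and> (x, c') \<in> glue h \<longrightarrow>
        (\<exists>e\<in>E'. (x, e) \<in> glue h \<and> (e, c) \<in> glue h \<and> (e, c') \<in> glue h)"
    using amalgam.meet_balanced_U[OF swapped C(1) C', unfolded glue_swapped] by (elim exE conjE)
  show "\<exists>E. finite E \<and> E \<subseteq> U \<union> V \<and> (\<forall>h\<in>points. \<forall>c\<in>C. \<forall>c'\<in>C. \<forall>x. (x, c) \<in> glue h \<and> (x, c') \<in> glue h \<longrightarrow>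
        (\<exists>e\<in>E. (x, e) \<in> glue h \<and> (e, c) \<in> glue h \<and> (e, c') \<in> glue h))"
  proof (intro exI[of _ "E \<union> E'"] conjI ballI allI impI; (elim conjE)?)
    fix h c c' x
    assume h: "h \<in> points" and c: "c \<in> C" "c' \<in> C" and x: "(x, c) \<in> glue h" "(x, c') \<in> glue h"
    then have "x \<in> U \<or> x \<in> V" using glue_carrier[OF h] by auto
    then show "\<exists>e\<in>E \<union> E'. (x, e) \<in> glue h \<and> (e, c) \<in> glue h \<and> (e, c') \<in> glue h"
      using E(3) E'(3) h c x by blast
  qed (use E E' in auto)
qed

lemma glue_balanced_family: "balanced_family (U \<union> V) glue (JU \<union> JV)"
proof
  fix x y assume "x \<in> U \<union> V" "y \<in> U \<union> V"
  then show "definable (\<lambda>h. (x, y) \<in> glue h)"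
    using definable_glue_U[of x y] amalgam.definable_glue_U[OF swapped, of x y, unfolded glue_swapped] by auto
qed (use glue_sup_structure glue_join_balanced glue_meet_balanced in auto)

lemma glue_balanced_structure: "balanced_structure (U \<union> V) glue (JU \<union> JV) (MU \<union> MV)"
  using glue_balanced_family amalgam.glue_balanced_family[OF dual] unfolding glue_dual
  by (rule balanced_structure.intro)

end

section \<open>The lattice of terms\<close>

locale term_lattice = balanced_structure R r J M
  for R :: "'r set" and r :: "('d::{distrib_lattice, order_bot} \<Rightarrow> bool) \<Rightarrow> 'r rel" and J M +
  assumes nonempty: "R \<noteq> {}" and total_at_False: "R \<times> R \<subseteq> r (\<lambda>_. False)"
begin

abbreviation "T \<equiv> {t. set_lterm t \<subseteq> R}"

definition cls :: "'r lterm \<Rightarrow> 'r lterm set" where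
  "cls s = {t \<in> T. \<forall>h\<in>points. term_le (r h) J M s t \<and> term_le (r h) J M t s}"

definition leq_at :: "('d \<Rightarrow> bool) \<Rightarrow> 'r lterm set rel" where
  "leq_at h = {(cls s, cls t) | s t. s \<in> T \<and> t \<in> T \<and> term_le (r h) J M s t}"

definition quot_leq :: "'r lterm set rel" where
  "quot_leq = (\<Inter>h\<in>points. leq_at h)"

text \<open>The operations are read off the order, which avoids folding a binary operation over an
  unordered set. Existence and uniqueness of the chosen elements follow from
  \<open>uniform_sup_exists\<close>, \<open>uniform_inf_exists\<close> and antisymmetry.\<close>

definition quot :: "'r lterm set plat" where
  "quot = \<lparr>carr = cls ` T, leq = quot_leq,
     bjoin = (\<lambda>X. if X \<in> fin_nonempty_subsets (cls ` T) then Some (SOME a. is_sup (cls ` T) quot_leq X a) else None),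
     bmeet = (\<lambda>X. if X \<in> fin_nonempty_subsets (cls ` T) then Some (SOME a. is_inf (cls ` T) quot_leq X a) else None)\<rparr>"

lemma quot_leq_mem: "p \<in> quot_leq \<longleftrightarrow> (\<forall>h\<in>points. p \<in> leq_at h)"
  by (simp add: quot_leq_def)

lemmas le_refl = prelattice_structure.term_le_refl[OF prelattice_structure]
lemmas le_trans = prelattice_structure.term_le_trans[OF prelattice_structure]

lemma cls_self: "s \<in> T \<Longrightarrow> s \<in> cls s"
  using le_refl unfolding cls_def by blast

lemma leq_at_iff:
  assumes h: "h \<in> points" and s: "s \<in> T" and t: "t \<in> T"
  shows "(cls s, cls t) \<in> leq_at h \<longleftrightarrow> term_le (r h) J M s t"
proof
  assume "(cls s, cls t) \<in> leq_at h"
  then obtain s' t' where st: "cls s = cls s'" "cls t = cls t'" "s' \<in> T" "t' \<in> T" "term_le (r h) J M s' t'"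
    unfolding leq_at_def by blast
  have "s \<in> cls s'" "t \<in> cls t'" using cls_self s t st by auto
  then have "term_le (r h) J M s s'" "term_le (r h) J M t' t" using h by (auto simp: cls_def)
  then show "term_le (r h) J M s t" using le_trans[OF h] st s t by meson
qed (use s t in \<open>auto simp: leq_at_def\<close>)

lemma quot_leq_iff:
  "s \<in> T \<Longrightarrow> t \<in> T \<Longrightarrow> (cls s, cls t) \<in> quot_leq \<longleftrightarrow> (\<forall>h\<in>points. term_le (r h) J M s t)"
  using leq_at_iff unfolding quot_leq_def by blast

lemma leq_at_carrier: "leq_at h \<subseteq> cls ` T \<times> cls ` T"
  by (auto simp: leq_at_def)

lemma quot_leq_carrier: "quot_leq \<subseteq> cls ` T \<times> cls ` T"
  using leq_at_carrier const_False_point unfolding quot_leq_def by blast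

lemma cls_eqI:
  assumes s: "s \<in> T" and t: "t \<in> T" and "\<And>h. h \<in> points \<Longrightarrow> term_le (r h) J M s t \<and> term_le (r h) J M t s"
  shows "cls s = cls t"
proof -
  have "x \<in> cls s \<longleftrightarrow> x \<in> cls t" for x
  proof (cases "x \<in> T")
    case x: True
    have "term_le (r h) J M s x \<longleftrightarrow> term_le (r h) J M t x" "term_le (r h) J M x s \<longleftrightarrow> term_le (r h) J M x t"
      if h: "h \<in> points" for h
      using assms(3)[OF h] le_trans[OF h _ _ s t x] le_trans[OF h _ _ t s x] le_trans[OF h _ _ x s t]
        le_trans[OF h _ _ x t s] by blast+
    then show ?thesis unfolding cls_def by auto
  qed (auto simp: cls_def)
  then show ?thesis by blast
qed

lemma antisym_quot_leq: "antisym quot_leq"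
proof (rule antisymI)
  fix A B assume a: "(A, B) \<in> quot_leq" "(B, A) \<in> quot_leq"
  then obtain s t where st: "s \<in> T" "t \<in> T" "A = cls s" "B = cls t" using quot_leq_carrier by blast
  then show "A = B" using a cls_eqI[OF st(1,2)] quot_leq_iff[OF st(1,2)] quot_leq_iff[OF st(2,1)] by blast
qed

lemma leq_at_preorder:
  assumes h: "h \<in> points"
  shows "preorder_on (cls ` T) (leq_at h)"
  unfolding preorder_on_def
proof (intro conjI)
  show "leq_at h \<subseteq> cls ` T \<times> cls ` T" by (rule leq_at_carrier)
  show "refl_on (cls ` T) (leq_at h)"
    unfolding refl_on_def using leq_at_iff[OF h] le_refl[OF h] by blast
  show "trans (leq_at h)"
  proof (rule transI)
    fix A B C assume a: "(A, B) \<in> leq_at h" "(B, C) \<in> leq_at h"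
    then obtain s t v where st: "s \<in> T" "t \<in> T" "v \<in> T" "A = cls s" "B = cls t" "C = cls v"
      using leq_at_carrier by blast
    then show "(A, C) \<in> leq_at h" using a leq_at_iff[OF h] le_trans[OF h _ _ st(1-3)] by blast
  qed
qed

lemma quot_leq_preorder: "preorder_on (cls ` T) quot_leq"
  unfolding preorder_on_def
proof (intro conjI)
  show "refl_on (cls ` T) quot_leq"
    using leq_at_preorder by (simp add: preorder_on_def refl_on_def quot_leq_mem)
  show "trans quot_leq"
    using leq_at_preorder unfolding preorder_on_def by (meson quot_leq_mem transD transI)
qed (rule quot_leq_carrier)

text \<open>One term must serve all points at once: a supremum for the intersection of preorders is
  not in general one for each of them, and the latter is what makes each \<open>leq_at h\<close> a
  congruence.\<close>

lemma uniform_sup_exists: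
  assumes "finite X" "X \<noteq> {}" "X \<subseteq> cls ` T"
  shows "\<exists>t\<in>T. \<forall>h\<in>points. is_sup (cls ` T) (leq_at h) X (cls t)"
  using assms
proof (induction rule: finite_ne_induct)
  case (singleton A)
  then obtain t where t: "t \<in> T" "A = cls t" by blast
  then have "is_sup (cls ` T) (leq_at h) {A} (cls t)" if "h \<in> points" for h
    using leq_at_iff[OF that] le_refl[OF that] by (auto simp: is_sup_def)
  then show ?case using t by blast
next
  case (insert A X)
  obtain s where s: "s \<in> T" "A = cls s" using insert.prems by blast
  obtain t where t: "t \<in> T" "\<And>h. h \<in> points \<Longrightarrow> is_sup (cls ` T) (leq_at h) X (cls t)"
    using insert.IH insert.prems by (meson insert_subset)
  have j: "Join s t \<in> T" using s t by simp
  have "is_sup (cls ` T) (leq_at h) (insert A X) (cls (Join s t))" if h: "h \<in> points" for h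
    unfolding is_sup_def
  proof (intro conjI ballI impI)
    note sup = t(2)[OF h, unfolded is_sup_def]
    note tr = leq_at_preorder[OF h, unfolded preorder_on_def, THEN conjunct2, THEN conjunct2, THEN transD]
    have st: "(cls s, cls (Join s t)) \<in> leq_at h" "(cls t, cls (Join s t)) \<in> leq_at h"
      using leq_at_iff[OF h] prelattice_structure.le_Join[OF prelattice_structure[OF h] s(1) t(1)] s t j by auto
    show "cls (Join s t) \<in> cls ` T" using j by blast
    fix x assume "x \<in> insert A X"
    then show "(x, cls (Join s t)) \<in> leq_at h" using sup st tr s by blast
  next
    note sup = t(2)[OF h, unfolded is_sup_def]
    fix B assume B: "B \<in> cls ` T" and ub: "\<forall>x\<in>insert A X. (x, B) \<in> leq_at h"
    then obtain v where v: "v \<in> T" "B = cls v" by blast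
    have "(cls t, B) \<in> leq_at h" "(cls s, B) \<in> leq_at h" using sup B ub s by blast+
    then show "(cls (Join s t), B) \<in> leq_at h"
      using leq_at_iff[OF h _ v(1)] v(2) s(1) t(1) j by (auto intro: term_le.Join_left)
  qed
  then show ?case using j by blast
qed

lemma uniform_inf_exists:
  assumes "finite X" "X \<noteq> {}" "X \<subseteq> cls ` T"
  shows "\<exists>t\<in>T. \<forall>h\<in>points. is_inf (cls ` T) (leq_at h) X (cls t)"
  using assms
proof (induction rule: finite_ne_induct)
  case (singleton A)
  then obtain t where t: "t \<in> T" "A = cls t" by blast
  then have "is_inf (cls ` T) (leq_at h) {A} (cls t)" if "h \<in> points" for h
    using leq_at_iff[OF that] le_refl[OF that] by (auto simp: is_inf_def)
  then show ?case using t by blast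
next
  case (insert A X)
  obtain s where s: "s \<in> T" "A = cls s" using insert.prems by blast
  obtain t where t: "t \<in> T" "\<And>h. h \<in> points \<Longrightarrow> is_inf (cls ` T) (leq_at h) X (cls t)"
    using insert.IH insert.prems by (meson insert_subset)
  have j: "Meet s t \<in> T" using s t by simp
  have "is_inf (cls ` T) (leq_at h) (insert A X) (cls (Meet s t))" if h: "h \<in> points" for h
    unfolding is_inf_def
  proof (intro conjI ballI impI)
    note inf = t(2)[OF h, unfolded is_inf_def]
    note tr = leq_at_preorder[OF h, unfolded preorder_on_def, THEN conjunct2, THEN conjunct2, THEN transD]
    have st: "(cls (Meet s t), cls s) \<in> leq_at h" "(cls (Meet s t), cls t) \<in> leq_at h"
      using leq_at_iff[OF h] prelattice_structure.Meet_le[OF prelattice_structure[OF h] s(1) t(1)] s t j by auto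
    show "cls (Meet s t) \<in> cls ` T" using j by blast
    fix x assume "x \<in> insert A X"
    then show "(cls (Meet s t), x) \<in> leq_at h" using inf st tr s by blast
  next
    note inf = t(2)[OF h, unfolded is_inf_def]
    fix B assume B: "B \<in> cls ` T" and lb: "\<forall>x\<in>insert A X. (B, x) \<in> leq_at h"
    then obtain v where v: "v \<in> T" "B = cls v" by blast
    have "(B, cls t) \<in> leq_at h" "(B, cls s) \<in> leq_at h" using inf B lb s by blast+
    then show "(B, cls (Meet s t)) \<in> leq_at h"
      using leq_at_iff[OF h v(1)] v(2) s(1) t(1) j by (auto intro: term_le.Meet_right)
  qed
  then show ?case using j by blast
qed

lemma quot_sup_if_uniform:
  assumes "\<And>h. h \<in> points \<Longrightarrow> is_sup (cls ` T) (leq_at h) X a"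
  shows "is_sup (cls ` T) quot_leq X a"
  using assms[OF const_False_point] assms by (simp add: is_sup_def quot_leq_mem)

lemma quot_inf_if_uniform:
  assumes "\<And>h. h \<in> points \<Longrightarrow> is_inf (cls ` T) (leq_at h) X a"
  shows "is_inf (cls ` T) quot_leq X a"
  using assms[OF const_False_point] assms by (simp add: is_inf_def quot_leq_mem)

lemma quot_sup_unique: "is_sup (cls ` T) quot_leq X a \<Longrightarrow> is_sup (cls ` T) quot_leq X b \<Longrightarrow> a = b"
  using antisym_quot_leq unfolding is_sup_def by (meson antisymD)

lemma quot_inf_unique: "is_inf (cls ` T) quot_leq X a \<Longrightarrow> is_inf (cls ` T) quot_leq X b \<Longrightarrow> a = b"
  using antisym_quot_leq unfolding is_inf_def by (meson antisymD)

lemma quot_join_eqI: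
  assumes "X \<in> fin_nonempty_subsets (cls ` T)" "is_sup (cls ` T) quot_leq X a"
  shows "bjoin quot X = Some a"
proof -
  have "(SOME a. is_sup (cls ` T) quot_leq X a) = a"
    using assms(2) quot_sup_unique[OF _ assms(2)] by (rule some_equality)
  then show ?thesis using assms(1) by (simp add: quot_def)
qed

lemma quot_meet_eqI:
  assumes "X \<in> fin_nonempty_subsets (cls ` T)" "is_inf (cls ` T) quot_leq X a"
  shows "bmeet quot X = Some a"
proof -
  have "(SOME a. is_inf (cls ` T) quot_leq X a) = a"
    using assms(2) quot_inf_unique[OF _ assms(2)] by (rule some_equality)
  then show ?thesis using assms(1) by (simp add: quot_def)
qed

text \<open>The uniform supremum is also a supremum for \<open>quot_leq\<close>, hence by uniqueness
  the value of the operation.\<close>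

lemma quot_join_uniform:
  assumes "bjoin quot X = Some a" "h \<in> points"
  shows "is_sup (cls ` T) (leq_at h) X a"
proof -
  have X: "X \<in> fin_nonempty_subsets (cls ` T)" using assms(1) by (simp add: quot_def split: if_splits)
  then obtain t where t: "\<And>h. h \<in> points \<Longrightarrow> is_sup (cls ` T) (leq_at h) X (cls t)"
    using uniform_sup_exists[of X] unfolding fin_nonempty_subsets_def by blast
  then have "a = cls t" using quot_join_eqI[OF X quot_sup_if_uniform] assms(1) by simp
  then show ?thesis using t assms(2) by simp
qed

lemma quot_meet_uniform:
  assumes "bmeet quot X = Some a" "h \<in> points"
  shows "is_inf (cls ` T) (leq_at h) X a"
proof -
  have X: "X \<in> fin_nonempty_subsets (cls ` T)" using assms(1) by (simp add: quot_def split: if_splits)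
  then obtain t where t: "\<And>h. h \<in> points \<Longrightarrow> is_inf (cls ` T) (leq_at h) X (cls t)"
    using uniform_inf_exists[of X] unfolding fin_nonempty_subsets_def by blast
  then have "a = cls t" using quot_meet_eqI[OF X quot_inf_if_uniform] assms(1) by simp
  then show ?thesis using t assms(2) by simp
qed

lemma quot_simps [simp]: "carr quot = cls ` T" "leq quot = quot_leq"
  by (simp_all add: quot_def)

lemma quot_dom: "dom (bjoin quot) = fin_nonempty_subsets (cls ` T)" "dom (bmeet quot) = fin_nonempty_subsets (cls ` T)"
  by (auto simp: quot_def split: if_splits)

lemma T_nonempty: "T \<noteq> {}"
proof -
  obtain x where "x \<in> R" using nonempty by blast
  then have "Gen x \<in> T" by simp
  then show ?thesis by blast
qed

lemma quot_prelatticeI: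
  assumes "preorder_on (cls ` T) \<theta>"
    and "\<And>X a. bjoin quot X = Some a \<Longrightarrow> is_sup (cls ` T) \<theta> X a"
    and "\<And>X a. bmeet quot X = Some a \<Longrightarrow> is_inf (cls ` T) \<theta> X a"
  shows "is_partial_prelattice (quot\<lparr>leq := \<theta>\<rparr>)"
proof -
  have "ran (bjoin quot) \<subseteq> cls ` T" "ran (bmeet quot) \<subseteq> cls ` T"
    using assms(2,3) by (auto simp: ran_def is_sup_def is_inf_def)
  then show ?thesis using assms T_nonempty quot_dom unfolding is_partial_prelattice_def by simp
qed

lemma quot_lattice: "is_lattice quot"
proof -
  have "is_partial_prelattice (quot\<lparr>leq := quot_leq\<rparr>)"
    using quot_leq_preorder quot_join_uniform quot_meet_uniform
    by (intro quot_prelatticeI quot_sup_if_uniform quot_inf_if_uniform) auto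
  moreover have "quot\<lparr>leq := quot_leq\<rparr> = quot" by (simp add: quot_def)
  ultimately show ?thesis
    using antisym_quot_leq quot_dom by (simp add: is_lattice_def is_partial_lattice_def)
qed

lemma quot_prelattice: "is_partial_prelattice quot"
  using quot_lattice by (simp add: is_lattice_def is_partial_lattice_def)

text \<open>Through these congruences, containment of a generated congruence in
  \<open>leq_at h\<close> can be tested on generators.\<close>

lemma congruence_leq_at: "h \<in> points \<Longrightarrow> congruence quot (leq_at h)"
  unfolding congruence_def
  using leq_at_preorder quot_join_uniform quot_meet_uniform
  by (intro conjI quot_prelatticeI) (auto simp: quot_leq_def)

lemma Gen_leq_at: "h \<in> points \<Longrightarrow> x \<in> R \<Longrightarrow> y \<in> R \<Longrightarrow> (cls (Gen x), cls (Gen y)) \<in> leq_at h \<longleftrightarrow> (x, y) \<in> r h"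
  using leq_at_iff[of h "Gen x" "Gen y"] prelattice_structure.Gen_le_Gen_iff[OF prelattice_structure] by simp

lemma Gen_join:
  assumes Xa: "(X, a) \<in> J"
  shows "bjoin quot ((\<lambda>x. cls (Gen x)) ` X) = Some (cls (Gen a))"
proof (rule quot_join_eqI[OF _ quot_sup_if_uniform])
  have X: "X \<subseteq> R" "finite X" "X \<noteq> {}" "a \<in> R"
    using sup_structureD(4)[OF low.sup_structure[OF const_False_point] Xa] by auto
  then have G: "\<And>x. x \<in> X \<Longrightarrow> Gen x \<in> T" "Gen a \<in> T" by auto
  then show "(\<lambda>x. cls (Gen x)) ` X \<in> fin_nonempty_subsets (cls ` T)"
    using X by (auto simp: fin_nonempty_subsets_def)
  fix h :: "'d \<Rightarrow> bool" assume h: "h \<in> points"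
  show "is_sup (cls ` T) (leq_at h) ((\<lambda>x. cls (Gen x)) ` X) (cls (Gen a))"
    unfolding is_sup_def
  proof (intro conjI ballI impI)
    show "cls (Gen a) \<in> cls ` T" using G by blast
    fix A assume "A \<in> (\<lambda>x. cls (Gen x)) ` X"
    then show "(A, cls (Gen a)) \<in> leq_at h"
      using sup_structureD(5)[OF low.sup_structure[OF h] Xa] Gen_leq_at[OF h] X by auto
  next
    fix B assume "B \<in> cls ` T" and ub: "\<forall>A\<in>(\<lambda>x. cls (Gen x)) ` X. (A, B) \<in> leq_at h"
    then obtain t where t: "t \<in> T" "B = cls t" by blast
    have "term_le (r h) J M (Gen x) t" if "x \<in> X" for x
      using ub that t(2) leq_at_iff[OF h G(1)[OF that] t(1)] by blast
    then have "term_le (r h) J M (Gen a) t"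
      by (rule prelattice_structure.Gen_join_least[OF prelattice_structure[OF h] Xa t(1)])
    then show "(cls (Gen a), B) \<in> leq_at h" using leq_at_iff[OF h G(2) t(1)] t(2) by simp
  qed
qed

lemma Gen_meet:
  assumes Xa: "(X, a) \<in> M"
  shows "bmeet quot ((\<lambda>x. cls (Gen x)) ` X) = Some (cls (Gen a))"
proof (rule quot_meet_eqI[OF _ quot_inf_if_uniform])
  have X: "X \<subseteq> R" "finite X" "X \<noteq> {}" "a \<in> R"
    using sup_structureD(4)[OF up.sup_structure[OF const_False_point] Xa] by auto
  then have G: "\<And>x. x \<in> X \<Longrightarrow> Gen x \<in> T" "Gen a \<in> T" by auto
  then show "(\<lambda>x. cls (Gen x)) ` X \<in> fin_nonempty_subsets (cls ` T)"
    using X by (auto simp: fin_nonempty_subsets_def)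
  fix h :: "'d \<Rightarrow> bool" assume h: "h \<in> points"
  show "is_inf (cls ` T) (leq_at h) ((\<lambda>x. cls (Gen x)) ` X) (cls (Gen a))"
    unfolding is_inf_def
  proof (intro conjI ballI impI)
    show "cls (Gen a) \<in> cls ` T" using G by blast
    fix A assume "A \<in> (\<lambda>x. cls (Gen x)) ` X"
    then show "(cls (Gen a), A) \<in> leq_at h"
      using sup_structureD(5)[OF up.sup_structure[OF h] Xa] Gen_leq_at[OF h] X by auto
  next
    fix B assume "B \<in> cls ` T" and lb: "\<forall>A\<in>(\<lambda>x. cls (Gen x)) ` X. (B, A) \<in> leq_at h"
    then obtain t where t: "t \<in> T" "B = cls t" by blast
    have "term_le (r h) J M t (Gen x)" if "x \<in> X" for x
      using lb that t(2) leq_at_iff[OF h t(1) G(1)[OF that]] by blast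
    then have "term_le (r h) J M t (Gen a)"
      by (rule prelattice_structure.Gen_meet_greatest[OF prelattice_structure[OF h] Xa t(1)])
    then show "(B, cls (Gen a)) \<in> leq_at h" using leq_at_iff[OF h t(1) G(2)] t(2) by simp
  qed
qed

lemma bin_join:
  assumes "s \<in> T" "t \<in> T" shows "bjoin quot {cls s, cls t} = Some (cls (Join s t))"
proof (rule quot_join_eqI[OF _ quot_sup_if_uniform])
  have j: "Join s t \<in> T" using assms by simp
  show "{cls s, cls t} \<in> fin_nonempty_subsets (cls ` T)" using assms by (auto simp: fin_nonempty_subsets_def)
  fix h :: "'d \<Rightarrow> bool" assume h: "h \<in> points"
  show "is_sup (cls ` T) (leq_at h) {cls s, cls t} (cls (Join s t))"
    unfolding is_sup_def
    using prelattice_structure.le_Join[OF prelattice_structure[OF h] assms] leq_at_iff[OF h] assms j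
    by (auto intro: term_le.Join_left)
qed

lemma bin_meet:
  assumes "s \<in> T" "t \<in> T" shows "bmeet quot {cls s, cls t} = Some (cls (Meet s t))"
proof (rule quot_meet_eqI[OF _ quot_inf_if_uniform])
  have j: "Meet s t \<in> T" using assms by simp
  show "{cls s, cls t} \<in> fin_nonempty_subsets (cls ` T)" using assms by (auto simp: fin_nonempty_subsets_def)
  fix h :: "'d \<Rightarrow> bool" assume h: "h \<in> points"
  show "is_inf (cls ` T) (leq_at h) {cls s, cls t} (cls (Meet s t))"
    unfolding is_inf_def
    using prelattice_structure.Meet_le[OF prelattice_structure[OF h] assms] leq_at_iff[OF h] assms j
    by (auto intro: term_le.Meet_right)
qed

lemma quot_generated: "sublattice quot hull ((\<lambda>x. cls (Gen x)) ` R) = carr quot"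
proof
  have "sublattice quot (cls ` T)"
    unfolding sublattice_def
    using quot_join_uniform[OF _ const_False_point] quot_meet_uniform[OF _ const_False_point]
    by (auto simp: is_sup_def is_inf_def)
  then show "sublattice quot hull ((\<lambda>x. cls (Gen x)) ` R) \<subseteq> carr quot"
    by (intro hull_minimal) auto
  have "cls t \<in> S" if S: "sublattice quot S" "(\<lambda>x. cls (Gen x)) ` R \<subseteq> S" and "t \<in> T" for S t
    using \<open>t \<in> T\<close>
  proof (induction t)
    case (Gen x)
    then show ?case using S(2) by auto
  next
    case (Join s t)
    then have "{cls s, cls t} \<in> fin_nonempty_subsets S" "s \<in> T" "t \<in> T" by (auto simp: fin_nonempty_subsets_def)
    then show ?case using S(1) bin_join unfolding sublattice_def by blast
  next
    case (Meet s t)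
    then have "{cls s, cls t} \<in> fin_nonempty_subsets S" "s \<in> T" "t \<in> T" by (auto simp: fin_nonempty_subsets_def)
    then show ?case using S(1) bin_meet unfolding sublattice_def by blast
  qed
  then show "carr quot \<subseteq> sublattice quot hull ((\<lambda>x. cls (Gen x)) ` R)"
    unfolding hull_def by auto
qed

text \<open>The element whose points are exactly those at which \<open>\<theta>\<close> fails. It is
  unique by \<open>points_eqI\<close>; its existence is shown for compact \<open>\<theta>\<close>,
  in \<open>val_point\<close>.\<close>

definition val :: "'r lterm set rel \<Rightarrow> 'd" where
  "val \<theta> = (SOME d. \<forall>h\<in>points. h d \<longleftrightarrow> \<not> \<theta> \<subseteq> leq_at h)"

lemma val_eqI:
  assumes "\<And>h. h \<in> points \<Longrightarrow> h d \<longleftrightarrow> \<not> \<theta> \<subseteq> leq_at h"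
  shows "val \<theta> = d"
  unfolding val_def
proof (rule some_equality)
  fix e assume e: "\<forall>h\<in>points. h e \<longleftrightarrow> \<not> \<theta> \<subseteq> leq_at h"
  show "e = d" by (rule points_eqI) (rule trans[OF bspec[OF e] assms[symmetric]])
qed (use assms in blast)

lemma hull_subset_leq_at: "h \<in> points \<Longrightarrow> congruence quot hull F \<subseteq> leq_at h \<longleftrightarrow> F \<subseteq> leq_at h"
  using congruence_hull_least[OF congruence_leq_at] hull_subset[of F "congruence quot"] by blast

lemma definable_leq_at:
  assumes "A \<in> cls ` T" "B \<in> cls ` T"
  shows "definable (\<lambda>h. (A, B) \<in> leq_at h)"
proof -
  obtain s t where st: "s \<in> T" "t \<in> T" "A = cls s" "B = cls t" using assms by blast
  show ?thesis unfolding st(3,4)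
    by (rule iffD2[OF definable_cong definable_term_le[of s t]]) (rule leq_at_iff, use st(1,2) in auto)
qed

text \<open>At the constant point everything is identified, so the truth set of a compact congruence is
  never the empty one and is therefore represented by an element of \<open>'d\<close>.\<close>

lemma val_point:
  assumes \<theta>: "\<theta> \<in> Con_c quot" and h: "h \<in> points"
  shows "h (val \<theta>) \<longleftrightarrow> \<not> \<theta> \<subseteq> leq_at h"
proof -
  obtain F where F: "finite F" "F \<subseteq> \<theta>" "F \<subseteq> carr quot \<times> carr quot" "\<theta> = congruence quot hull F"
    using compact_finitely_generated[OF quot_prelattice \<theta>] .
  have "definable (\<lambda>h. \<forall>p\<in>F. (fst p, snd p) \<in> leq_at h)"
    using F by (intro definable_ball definable_leq_at) auto
  moreover have "cls ` T \<times> cls ` T \<subseteq> leq_at (\<lambda>_. False)"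
    using prelattice_structure.total_term_le[OF prelattice_structure[OF const_False_point] nonempty total_at_False]
    by (auto simp: leq_at_iff const_False_point)
  then have "\<forall>p\<in>F. (fst p, snd p) \<in> leq_at (\<lambda>_. False)" using F(3) by auto
  ultimately obtain d where "\<forall>h\<in>points. (\<forall>p\<in>F. (fst p, snd p) \<in> leq_at h) \<longleftrightarrow> \<not> h d"
    unfolding definable_def using const_False_point by (elim disjE exE) auto
  then have d: "h d \<longleftrightarrow> \<not> \<theta> \<subseteq> leq_at h" if "h \<in> points" for h
    using hull_subset_leq_at[OF that] F(4) that by (auto simp: subset_iff)
  then show ?thesis using val_eqI[OF d] h by simp
qed

text \<open>A join is contained in the congruence \<open>leq_at h\<close> exactly when both joinands
  are, and failure of this conjunction is what \<open>h\<close> of a \<open>sup\<close>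
  expresses.\<close>

lemma val_join_zero_hom: "join_zero_hom quot val"
  unfolding join_zero_hom_def
proof (intro conjI ballI)
  show "val (leq quot) = bot" by (rule val_eqI) (auto simp: pointsD(1) quot_leq_def)
  fix \<alpha> \<beta> assume ab: "\<alpha> \<in> Con_c quot" "\<beta> \<in> Con_c quot"
  show "val (con_join quot \<alpha> \<beta>) = sup (val \<alpha>) (val \<beta>)"
    unfolding con_join_def
    by (rule val_eqI) (simp add: hull_subset_leq_at pointsD(2) val_point ab)
qed

text \<open>Value \<open>bot\<close> means that no point sees a failure, and the order of
  \<open>quot\<close> is the intersection of the orders at all points.\<close>

lemma val_isolates_bot:
  assumes \<theta>: "\<theta> \<in> Con_c quot"
  shows "val \<theta> = bot \<longleftrightarrow> \<theta> = leq quot"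
proof
  assume "val \<theta> = bot"
  then have "\<theta> \<subseteq> leq_at h" if "h \<in> points" for h using val_point[OF \<theta> that] pointsD(1)[OF that] by simp
  then have "\<theta> \<subseteq> quot_leq" unfolding quot_leq_def by blast
  moreover have "quot_leq \<subseteq> \<theta>" using \<theta> congruenceD(1)[of quot \<theta>] by (simp add: Con_c_def)
  ultimately show "\<theta> = leq quot" by simp
qed (use val_join_zero_hom in \<open>simp add: join_zero_hom_def\<close>)

end

section \<open>The amalgam\<close>

definition lift_ops :: "('a \<Rightarrow> 'r) \<Rightarrow> ('a set \<rightharpoonup> 'a) \<Rightarrow> ('r set \<times> 'r) set" where
  "lift_ops i op = {(i ` X, i a) | X a. op X = Some a}"

lemma sup_structure_image:
  assumes i: "inj i" and pre: "preorder_on A \<theta>"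
    and op: "\<And>X a. op X = Some a \<Longrightarrow> X \<subseteq> A \<and> finite X \<and> X \<noteq> {}"
    and sup: "\<And>X a. op X = Some a \<Longrightarrow> is_sup A \<theta> X a"
  shows "sup_structure (i ` A) (map_prod i i ` \<theta>) (lift_ops i op)"
  unfolding sup_structure_def
proof (intro conjI allI impI)
  have mem: "(i x, i y) \<in> map_prod i i ` \<theta> \<longleftrightarrow> (x, y) \<in> \<theta>" for x y
    using inj_image_mem_iff[OF prod.inj_map[OF i i], of "(x, y)" \<theta>] by simp
  show "preorder_on (i ` A) (map_prod i i ` \<theta>)"
    unfolding preorder_on_def
  proof (intro conjI)
    show "map_prod i i ` \<theta> \<subseteq> i ` A \<times> i ` A" using pre by (auto simp: preorder_on_def)
    show "refl_on (i ` A) (map_prod i i ` \<theta>)" using pre mem by (auto simp: preorder_on_def refl_on_def)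
    show "trans (map_prod i i ` \<theta>)"
      using pre i by (auto simp: preorder_on_def trans_def inj_eq intro!: mem[THEN iffD2])
  qed
  fix Y b assume "(Y, b) \<in> lift_ops i op"
  then obtain X a where Xa: "op X = Some a" "Y = i ` X" "b = i a" by (auto simp: lift_ops_def)
  show "Y \<subseteq> i ` A" "finite Y" "Y \<noteq> {}" using op[OF Xa(1)] Xa by auto
  show "is_sup (i ` A) (map_prod i i ` \<theta>) Y b"
    using sup[OF Xa(1)] unfolding Xa(2,3) is_sup_def by (auto simp: mem)
qed

lemma point_le_structures:
  assumes i: "inj i" and P: "is_partial_prelattice P" and \<mu>: "join_zero_hom P \<mu>" and h: "h \<in> points"
  shows "sup_structure (i ` carr P) (map_prod i i ` point_le P \<mu> h) (lift_ops i (bjoin P))"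
    and "sup_structure (i ` carr P) ((map_prod i i ` point_le P \<mu> h)\<inverse>) (lift_ops i (bmeet P))"
proof -
  note c = congruence_point_le[OF P \<mu> h]
  show "sup_structure (i ` carr P) (map_prod i i ` point_le P \<mu> h) (lift_ops i (bjoin P))"
    using congruenceD(2,6)[OF c] plat_opsD(1)[OF P] by (intro sup_structure_image[OF i]) blast+
  have conv: "(map_prod i i ` point_le P \<mu> h)\<inverse> = map_prod i i ` (point_le P \<mu> h)\<inverse>" by force
  have "preorder_on (carr P) ((point_le P \<mu> h)\<inverse>)"
    using congruenceD(2)[OF c] by (auto simp: preorder_on_def refl_on_def)
  moreover have "is_sup (carr P) ((point_le P \<mu> h)\<inverse>) X a" if "bmeet P X = Some a" for X a
    using congruenceD(7)[OF c that] by (simp add: is_sup_def is_inf_def)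
  ultimately show "sup_structure (i ` carr P) ((map_prod i i ` point_le P \<mu> h)\<inverse>) (lift_ops i (bmeet P))"
    unfolding conv using plat_opsD(2)[OF P] by (intro sup_structure_image[OF i]) blast+
qed

lemma lift_mem_iff: "inj i \<Longrightarrow> (i x, i y) \<in> map_prod i i ` \<theta> \<longleftrightarrow> (x, y) \<in> \<theta>"
  using inj_image_mem_iff[OF prod.inj_map, of i i "(x, y)" \<theta>] by simp

lemma definable_point_le:
  assumes "inj i" "x \<in> i ` carr P" "y \<in> i ` carr P"
  shows "definable (\<lambda>h. (x, y) \<in> map_prod i i ` point_le P \<mu> h)"
  using assms by (auto simp: definable_def lift_mem_iff point_le_def)

lemma lift_ops_total:
  assumes "inj i" "finite (carr P) \<or> is_lattice P"
  shows "finite (i ` carr P) \<or> (\<forall>Y. Y \<subseteq> i ` carr P \<and> finite Y \<and> Y \<noteq> {} \<longrightarrow>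
     (\<exists>a. (Y, a) \<in> lift_ops i (bjoin P)) \<and> (\<exists>a. (Y, a) \<in> lift_ops i (bmeet P)))"
proof (cases "finite (carr P)")
  case False
  then have L: "is_lattice P" using assms(2) by simp
  have "(\<exists>a. (Y, a) \<in> lift_ops i (bjoin P)) \<and> (\<exists>a. (Y, a) \<in> lift_ops i (bmeet P))"
    if Y: "Y \<subseteq> i ` carr P" "finite Y" "Y \<noteq> {}" for Y
  proof -
    obtain X where X: "X \<subseteq> carr P" "finite X" "Y = i ` X" using finite_subset_image[OF Y(2,1)] by blast
    then have "X \<in> fin_nonempty_subsets (carr P)" using Y(3) by (auto simp: fin_nonempty_subsets_def)
    then have "X \<in> dom (bjoin P)" "X \<in> dom (bmeet P)" using L by (simp_all add: is_lattice_def)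
    then show ?thesis using X(3) unfolding lift_ops_def by blast
  qed
  then show ?thesis by blast
qed simp

text \<open>The preorder that \<open>P\<close> induces on \<open>K\<close> depends only on
  \<open>\<mu>\<close> composed with \<open>Con_c_map P f\<close>; the commutation hypothesis thus
  gives \<open>N_embed\<close>.\<close>

lemma point_le_hom_iff:
  assumes "is_partial_prelattice K" "is_partial_prelattice P" "plat_hom K P f" "k \<in> carr K" "k' \<in> carr K"
  shows "(f k, f k') \<in> point_le P \<mu> h \<longleftrightarrow> \<not> h (\<mu> (Con_c_map P f (congruence K hull {(k, k')})))"
proof -
  have "f k \<in> carr P" "f k' \<in> carr P" using assms by (auto simp: plat_hom_def)
  then show ?thesis by (simp add: point_le_def Con_c_map_principal[OF assms])
qed

lemma lattice_amalgam:
  fixes K :: "'k plat" and P :: "'p plat" and Q :: "'q plat"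
    and f :: "'k \<Rightarrow> 'p" and g :: "'k \<Rightarrow> 'q"
    and \<mu> :: "'p rel \<Rightarrow> 'd::{distrib_lattice, order_bot}" and \<nu> :: "'q rel \<Rightarrow> 'd"
    and i :: "'p \<Rightarrow> 'r" and j :: "'q \<Rightarrow> 'r"
  assumes K: "is_lattice K" "finite (carr K)"
    and P: "is_partial_prelattice P" "finite (carr P) \<or> is_lattice P"
    and Q: "is_partial_prelattice Q" "finite (carr Q) \<or> is_lattice Q"
    and f: "plat_hom K P f" and g: "plat_hom K Q g"
    and \<mu>: "join_zero_hom P \<mu>" and \<nu>: "join_zero_hom Q \<nu>"
    and comm: "\<forall>\<alpha>\<in>Con_c K. \<mu> (Con_c_map P f \<alpha>) = \<nu> (Con_c_map Q g \<alpha>)"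
    and i: "inj i" and j: "inj j" and ij: "range i \<inter> range j = {}"
  shows "amalgam (i ` carr P) (j ` carr Q)
    (\<lambda>h. map_prod i i ` point_le P \<mu> h) (\<lambda>h. map_prod j j ` point_le Q \<nu> h)
    (lift_ops i (bjoin P)) (lift_ops j (bjoin Q)) (lift_ops i (bmeet P)) (lift_ops j (bmeet Q))
    ((\<lambda>k. (i (f k), j (g k))) ` carr K)" (is "amalgam _ _ _ _ _ _ _ _ ?N")
proof
  have K': "is_partial_prelattice K" using K(1) by (simp add: is_lattice_def is_partial_lattice_def)
  show "i ` carr P \<inter> j ` carr Q = {}" using ij by blast
  show "finite ?N" using K(2) by simp
  show "?N \<subseteq> i ` carr P \<times> j ` carr Q" using f g by (auto simp: plat_hom_def)
  show "(a, a') \<in> map_prod i i ` point_le P \<mu> h \<longleftrightarrow> (b, b') \<in> map_prod j j ` point_le Q \<nu> h"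
    if ab: "(a, b) \<in> ?N" "(a', b') \<in> ?N" for h :: "'d \<Rightarrow> bool" and a b a' b'
  proof -
    obtain k k' where k: "k \<in> carr K" "k' \<in> carr K" "a = i (f k)" "b = j (g k)" "a' = i (f k')" "b' = j (g k')"
      using ab by blast
    have "congruence K hull {(k, k')} \<in> Con_c K" using k by (intro finitely_generated_compact[OF K']) auto
    then show ?thesis
      using comm k by (simp add: lift_mem_iff i j point_le_hom_iff[OF K' P(1) f] point_le_hom_iff[OF K' Q(1) g])
  qed
  have sub: "\<exists>Z. Z \<in> fin_nonempty_subsets (carr K) \<and> fst ` Y = i ` f ` Z \<and> snd ` Y = j ` g ` Z"
    if Y: "Y \<subseteq> ?N" "finite Y" "Y \<noteq> {}" for Y
  proof -
    obtain Z where "Z \<subseteq> carr K" "finite Z" "Y = (\<lambda>k. (i (f k), j (g k))) ` Z"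
      \<comment> \<open>Only some finite preimage is available, since distinct elements of
        \<open>K\<close> may yield the same pair.\<close>
      using finite_subset_image[OF Y(2,1)] by blast
    then show ?thesis using Y(3) by (intro exI[of _ Z]) (auto simp: fin_nonempty_subsets_def image_image)
  qed
  show "\<exists>(a, b)\<in>?N. (fst ` Y, a) \<in> lift_ops i (bjoin P) \<and> (snd ` Y, b) \<in> lift_ops j (bjoin Q)"
    if Y: "Y \<subseteq> ?N" "finite Y" "Y \<noteq> {}" for Y
  proof -
    obtain Z where Z: "Z \<in> fin_nonempty_subsets (carr K)" "fst ` Y = i ` f ` Z" "snd ` Y = j ` g ` Z"
      using sub[OF Y] by (elim exE conjE)
    obtain k where k: "bjoin K Z = Some k" using Z(1) K(1) by (metis domD is_lattice_def)
    then have "k \<in> carr K" "bjoin P (f ` Z) = Some (f k)" "bjoin Q (g ` Z) = Some (g k)"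
      using f g plat_opsD(1)[OF K'] by (auto simp: plat_hom_def)
    then show ?thesis using Z(2,3) by (auto simp: lift_ops_def)
  qed
  show "\<exists>(a, b)\<in>?N. (fst ` Y, a) \<in> lift_ops i (bmeet P) \<and> (snd ` Y, b) \<in> lift_ops j (bmeet Q)"
    if Y: "Y \<subseteq> ?N" "finite Y" "Y \<noteq> {}" for Y
  proof -
    obtain Z where Z: "Z \<in> fin_nonempty_subsets (carr K)" "fst ` Y = i ` f ` Z" "snd ` Y = j ` g ` Z"
      using sub[OF Y] by (elim exE conjE)
    obtain k where k: "bmeet K Z = Some k" using Z(1) K(1) by (metis domD is_lattice_def)
    then have "k \<in> carr K" "bmeet P (f ` Z) = Some (f k)" "bmeet Q (g ` Z) = Some (g k)"
      using f g plat_opsD(2)[OF K'] by (auto simp: plat_hom_def)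
    then show ?thesis using Z(2,3) by (auto simp: lift_ops_def)
  qed
qed (rule point_le_structures definable_point_le lift_ops_total; (rule assms | assumption))+

context term_lattice
begin

text \<open>Formulated for an arbitrary component so as to cover both \<open>P\<close> and
  \<open>Q\<close>. The two values agree because each holds at \<open>h\<close> exactly when some
  pair of \<open>\<alpha>\<close> fails there.\<close>

lemma component_hom:
  assumes P: "is_partial_prelattice P" and \<mu>: "join_zero_hom P \<mu>"
    and i: "i ` carr P \<subseteq> R" "lift_ops i (bjoin P) \<subseteq> J" "lift_ops i (bmeet P) \<subseteq> M"
    and r: "\<And>h x y. h \<in> points \<Longrightarrow> x \<in> carr P \<Longrightarrow> y \<in> carr P \<Longrightarrow> (i x, i y) \<in> r h \<longleftrightarrow> (x, y) \<in> point_le P \<mu> h"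
  defines "F \<equiv> \<lambda>x. cls (Gen (i x))"
  shows "plat_hom P quot F" and "\<alpha> \<in> Con_c P \<Longrightarrow> \<mu> \<alpha> = val (Con_c_map quot F \<alpha>)"
proof -
  have iR: "i x \<in> R" if "x \<in> carr P" for x using that i(1) by blast
  have leq: "(F x, F y) \<in> leq_at h \<longleftrightarrow> (x, y) \<in> point_le P \<mu> h"
    if "h \<in> points" "x \<in> carr P" "y \<in> carr P" for h x y
    using Gen_leq_at[OF that(1) iR iR] r that by (simp add: F_def)
  show "plat_hom P quot F"
    unfolding plat_hom_def
  proof (intro conjI allI impI)
    show "F ` carr P \<subseteq> carr quot" using iR by (auto simp: F_def)
    have l: "leq P \<subseteq> carr P \<times> carr P" using congruenceD(3)[OF congruence_prelattice[OF P]] .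
    have "(F x, F y) \<in> leq_at h" if "(x, y) \<in> leq P" "h \<in> points" for x y h
      using leq[OF that(2)] congruenceD(1)[OF congruence_point_le[OF P \<mu> that(2)]] that(1) l by blast
    then show "\<forall>(x, y)\<in>leq P. (F x, F y) \<in> leq quot" by (auto simp: quot_leq_mem)
    show "bjoin quot (F ` X) = Some (F a)" if "bjoin P X = Some a" for X a
    proof -
      have "(i ` X, i a) \<in> J" using that i(2) by (auto simp: lift_ops_def)
      from Gen_join[OF this] show ?thesis by (simp add: F_def image_image)
    qed
    show "bmeet quot (F ` X) = Some (F a)" if "bmeet P X = Some a" for X a
    proof -
      have "(i ` X, i a) \<in> M" using that i(3) by (auto simp: lift_ops_def)
      from Gen_meet[OF this] show ?thesis by (simp add: F_def image_image)
    qed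
  qed
  assume \<alpha>: "\<alpha> \<in> Con_c P"
  then have sub: "\<alpha> \<subseteq> carr P \<times> carr P" using congruenceD(3)[of P \<alpha>] by (simp add: Con_c_def)
  have "h (\<mu> \<alpha>) \<longleftrightarrow> \<not> Con_c_map quot F \<alpha> \<subseteq> leq_at h" if h: "h \<in> points" for h
  proof -
    have "Con_c_map quot F \<alpha> \<subseteq> leq_at h \<longleftrightarrow> (\<forall>(x, y)\<in>\<alpha>. (F x, F y) \<in> leq_at h)"
      unfolding Con_c_map_def hull_subset_leq_at[OF h] by auto
    also have "\<dots> \<longleftrightarrow> (\<forall>p\<in>\<alpha>. \<not> h (\<mu> (congruence P hull {p})))"
      using sub leq[OF h] by (fastforce simp: point_le_def)
    finally show ?thesis using join_zero_hom_point_iff[OF P \<mu> h \<alpha>] by blast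
  qed
  then show "\<mu> \<alpha> = val (Con_c_map quot F \<alpha>)" by (rule val_eqI[symmetric])
qed

end

theorem theoremB:
  fixes K :: "'k plat" and P :: "'p plat" and Q :: "'q plat"
    and f :: "'k \<Rightarrow> 'p" and g :: "'k \<Rightarrow> 'q"
    and \<mu> :: "'p rel \<Rightarrow> 'd::{distrib_lattice, order_bot}" and \<nu> :: "'q rel \<Rightarrow> 'd"
  assumes "is_lattice K" and "finite (carr K)"
    and "is_partial_lattice P" and "finite (carr P) \<or> is_lattice P"
    and "is_partial_lattice Q" and "finite (carr Q) \<or> is_lattice Q"
    and "plat_hom K P f" and "plat_hom K Q g"
    and "join_zero_hom P \<mu>" and "join_zero_hom Q \<nu>"
    and "\<forall>\<alpha>\<in>Con_c K. \<mu> (Con_c_map P f \<alpha>) = \<nu> (Con_c_map Q g \<alpha>)"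
  shows "\<exists>(L :: ('p + 'q) lterm set plat) f' g' (\<phi> :: ('p + 'q) lterm set rel \<Rightarrow> 'd).
    is_lattice L \<and> plat_hom P L f' \<and> plat_hom Q L g' \<and> join_zero_hom L \<phi> \<and>
    (\<forall>x\<in>carr K. f' (f x) = g' (g x)) \<and>
    (\<forall>\<alpha>\<in>Con_c P. \<mu> \<alpha> = \<phi> (Con_c_map L f' \<alpha>)) \<and>
    (\<forall>\<beta>\<in>Con_c Q. \<nu> \<beta> = \<phi> (Con_c_map L g' \<beta>)) \<and>
    sublattice L hull (f' ` carr P \<union> g' ` carr Q) = carr L \<and>
    (\<forall>\<theta>\<in>Con_c L. \<phi> \<theta> = bot \<longleftrightarrow> \<theta> = leq L)"
proof -
  let ?i = "Inl :: 'p \<Rightarrow> 'p + 'q" and ?j = "Inr :: 'q \<Rightarrow> 'p + 'q"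
  let ?u = "\<lambda>h. map_prod ?i ?i ` point_le P \<mu> h" and ?v = "\<lambda>h. map_prod ?j ?j ` point_le Q \<nu> h"
  let ?N = "(\<lambda>k. (?i (f k), ?j (g k))) ` carr K"
  let ?R = "?i ` carr P \<union> ?j ` carr Q"
  let ?J = "lift_ops ?i (bjoin P) \<union> lift_ops ?j (bjoin Q)"
  let ?M = "lift_ops ?i (bmeet P) \<union> lift_ops ?j (bmeet Q)"
  have P: "is_partial_prelattice P" and Q: "is_partial_prelattice Q"
    using assms(3,5) by (simp_all add: is_partial_lattice_def)
  have Pne: "carr P \<noteq> {}" and Kne: "carr K \<noteq> {}"
    using assms(1) P by (auto simp: is_lattice_def is_partial_lattice_def is_partial_prelattice_def)
  interpret A: amalgam "?i ` carr P" "?j ` carr Q" ?u ?v "lift_ops ?i (bjoin P)" "lift_ops ?j (bjoin Q)"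
      "lift_ops ?i (bmeet P)" "lift_ops ?j (bmeet Q)" ?N
    using assms P Q by (intro lattice_amalgam) auto
  interpret L: term_lattice ?R A.glue ?J ?M
  proof (rule term_lattice.intro[OF A.glue_balanced_structure], unfold_locales)
    show "?R \<noteq> {}" using Pne by blast
    obtain k where k: "k \<in> carr K" using Kne by blast
    then have c: "f k \<in> carr P" "g k \<in> carr Q" using assms(7,8) by (auto simp: plat_hom_def)
    \<comment> \<open>At the constant point no inequality fails, so each component is totally
      related.\<close>
    have u: "(?i x, ?i y) \<in> ?u (\<lambda>_. False)" if "x \<in> carr P" "y \<in> carr P" for x y
      using that by (auto simp: point_le_def)
    have v: "(?j x, ?j y) \<in> ?v (\<lambda>_. False)" if "x \<in> carr Q" "y \<in> carr Q" for x y
      using that by (auto simp: point_le_def)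
    \<comment> \<open>Any one element \<open>k\<close> of \<open>K\<close> provides a crossing
      between arbitrary elements.\<close>
    have "(?i x, ?j y) \<in> A.glue (\<lambda>_. False)" "(?j y, ?i x) \<in> A.glue (\<lambda>_. False)"
      if "x \<in> carr P" "y \<in> carr Q" for x y
    proof -
      have N: "(?i (f k), ?j (g k)) \<in> ?N" "(?j (g k), ?i (f k)) \<in> ?N\<inverse>" using k by auto
      show "(?i x, ?j y) \<in> A.glue (\<lambda>_. False)"
        using relcompI[OF relcompI[OF u[OF that(1) c(1)] N(1)] v[OF c(2) that(2)]]
        unfolding A.glue_def by (simp add: O_assoc)
      show "(?j y, ?i x) \<in> A.glue (\<lambda>_. False)"
        using relcompI[OF relcompI[OF v[OF that(2) c(2)] N(2)] u[OF c(1) that(1)]]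
        unfolding A.glue_def by (simp add: O_assoc)
    qed
    moreover have "(?i x, ?i y) \<in> A.glue (\<lambda>_. False)" if "x \<in> carr P" "y \<in> carr P" for x y
      using u[OF that] by (simp add: A.glue_def)
    moreover have "(?j x, ?j y) \<in> A.glue (\<lambda>_. False)" if "x \<in> carr Q" "y \<in> carr Q" for x y
      using v[OF that] by (simp add: A.glue_def)
    ultimately show "?R \<times> ?R \<subseteq> A.glue (\<lambda>_. False)" by auto
  qed
  let ?f = "\<lambda>x. L.cls (Gen (?i x))" and ?g = "\<lambda>x. L.cls (Gen (?j x))"
  have r: "(?i x, ?i y) \<in> A.glue h \<longleftrightarrow> (x, y) \<in> point_le P \<mu> h"
    if "h \<in> points" "x \<in> carr P" "y \<in> carr P" for h x y
    using A.glue_UU[OF that(1)] that(2,3) by (simp add: lift_mem_iff)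
  have r': "(?j x, ?j y) \<in> A.glue h \<longleftrightarrow> (x, y) \<in> point_le Q \<nu> h"
    if "h \<in> points" "x \<in> carr Q" "y \<in> carr Q" for h x y
    using A.glue_VV[OF that(1)] that(2,3) by (simp add: lift_mem_iff)
  have f: "plat_hom P L.quot ?f" "\<forall>\<alpha>\<in>Con_c P. \<mu> \<alpha> = L.val (Con_c_map L.quot ?f \<alpha>)"
    using L.component_hom[OF P assms(9) _ _ _ r] by auto
  have g: "plat_hom Q L.quot ?g" "\<forall>\<beta>\<in>Con_c Q. \<nu> \<beta> = L.val (Con_c_map L.quot ?g \<beta>)"
    using L.component_hom[OF Q assms(10) _ _ _ r'] by auto
  \<comment> \<open>The two generators form a pair of \<open>N\<close>, so they are glued in both
    directions at every point.\<close>
  have "?f (f k) = ?g (g k)" if k: "k \<in> carr K" for k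
  proof (rule L.cls_eqI)
    have c: "f k \<in> carr P" "g k \<in> carr Q" using k assms(7,8) by (auto simp: plat_hom_def)
    then show "Gen (?i (f k)) \<in> L.T" "Gen (?j (g k)) \<in> L.T" by auto
    fix h :: "'d \<Rightarrow> bool" assume h: "h \<in> points"
    then show "term_le (A.glue h) ?J ?M (Gen (?i (f k))) (Gen (?j (g k))) \<and>
        term_le (A.glue h) ?J ?M (Gen (?j (g k))) (Gen (?i (f k)))"
      using prelattice_structure.Gen_le_Gen_iff[OF L.prelattice_structure[OF h]] A.glue_N[OF h] c k by auto
  qed
  moreover have "sublattice L.quot hull (?f ` carr P \<union> ?g ` carr Q) = carr L.quot"
    using L.quot_generated by (simp add: image_Un image_image)
  ultimately show ?thesis
    using L.quot_lattice f g L.val_join_zero_hom L.val_isolates_bot by blast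
qed

end
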